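(* Let $\Gamma\subseteq\mathrm{SL}(2,\mathbb{Z})$ be a finitely generated Fuchsian group of the first kind with at least one parabolic class. Let $k\in\mathbb{R}$, $\chi$ a multiplier system of weight $-k$ on $\Gamma$, and $\rho$ a $p$-dimensional unitary representation of $\Gamma$. Then $H^1_{-k,\chi,\rho}(\Gamma,\mathcal{P})=\tilde H^1_{-k,\chi,\rho}(\Gamma,\mathcal{P})$, i.e. every cocycle in $\mathcal{P}$ is parabolic.
   Context: $\tau=u+iv\in\mathbb{H}$; real powers use a fixed standard branch. A multiplier system of weight $w$ on $\Gamma$ is $\chi:\Gamma\to\mathbb{C}$ with $|\chi|=1$, $\chi(\gamma_1\gamma_2)(c_3\tau+d_3)^w=\chi(\gamma_1)\chi(\gamma_2)(c_1\gamma_2\tau+d_1)^w(c_2\tau+d_2)^w$ and $\chi(-I)=e^{\pi iw}$. Slash operator: $(f|_{-k,\chi,\rho}\gamma)(\tau)=\chi(\gamma)^{-1}(c\tau+d)^{k}\rho(\gamma)^{-1}f(\gamma\tau)$. $\mathcal{P}$ is the space of holomorphic $G=\sum_{j=1}^p G_j\mathbf{e}_j:\mathbb{H}\to\mathbb{C}^p$ with $|G_j(\tau)|<K(|\tau|^{\alpha}+v^{-\sigma})$ for some positive constants $K,\alpha,\sigma$. Cocycles: families $\{g_\gamma\}_{\gamma\in\Gamma}\subset\mathcal{P}$ with $g_{\gamma_1\gamma_2}=g_{\gamma_2}+g_{\gamma_1}|_{-k,\chi,\rho}\gamma_2$; coboundaries: $g_\gamma=p|_{-k,\chi,\rho}\gamma-p$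 for a fixed $p\in\mathcal{P}$; parabolic cocycles: for each parabolic $B\in\Gamma$ there is $Q_B\in\mathcal{P}$ with $g_B=Q_B|_{-k,\chi,\rho}B-Q_B$. $H^1_{-k,\chi,\rho}(\Gamma,\mathcal{P})$ is cocycles modulo coboundaries, $\tilde H^1_{-k,\chi,\rho}(\Gamma,\mathcal{P})$ is parabolic cocycles modulo coboundaries. *)

theory Defs
  imports
    "HOL-Complex_Analysis.Complex_Analysis"
    "HOL-Algebra.Generated_Groups"
    "HOL-Library.Function_Algebras"
begin

abbreviation upper_half_plane :: "complex set" (\<open>\<H>\<close>) where
  "\<H> \<equiv> {\<tau>. Im \<tau> > 0}"

definition SL2R :: "(real^2^2) monoid" where
  "SL2R = \<lparr>carrier = {A. det A = 1}, mult = (**), one = mat 1\<rparr>"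

definition SL2Z :: "(real^2^2) set" where
  "SL2Z = {A. det A = 1 \<and> (\<forall>i j. A $ i $ j \<in> \<int>)}"

definition act :: "real^2^2 \<Rightarrow> complex \<Rightarrow> complex" where
  "act A = moebius (of_real (A$1$1)) (of_real (A$1$2)) (of_real (A$2$1)) (of_real (A$2$2))"

definition aut_denom :: "real^2^2 \<Rightarrow> complex \<Rightarrow> complex" where
  "aut_denom A \<tau> = of_real (A$2$1) * \<tau> + of_real (A$2$2)"

definition parabolic :: "real^2^2 \<Rightarrow> bool" where
  "parabolic A \<longleftrightarrow> det A = 1 \<and> \<bar>trace A\<bar> = 2 \<and> A \<noteq> mat 1 \<and> A \<noteq> - mat 1"


text \<open>
  The Riemann sphere is the one-point compactification of the complex plane, with
  \<^const>\<open>None\<close> as the point at infinity. A group is of the first kind if every point of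
  the extended real line is an accumulation point of some orbit of a point of \<open>\<H>\<close>.
\<close>

definition limit_set :: "(real^2^2) set \<Rightarrow> complex option set" where
  "limit_set \<Gamma> = (\<Union>z\<in>\<H>. Alexandroff_compactification euclidean derived_set_of
      ((\<lambda>A. Some (act A z)) ` \<Gamma>))"

definition fuchsian_group :: "(real^2^2) set \<Rightarrow> bool" where
  "fuchsian_group \<Gamma> \<longleftrightarrow> subgroup \<Gamma> SL2R \<and> discrete \<Gamma>"

definition first_kind :: "(real^2^2) set \<Rightarrow> bool" where
  "first_kind \<Gamma> \<longleftrightarrow> limit_set \<Gamma> = insert None (Some ` \<real>)"

definition finitely_generated :: "(real^2^2) set \<Rightarrow> bool" where
  "finitely_generated \<Gamma> \<longleftrightarrow> (\<exists>S. finite S \<and> S \<subseteq> carrier SL2R \<and> generate SL2R S = \<Gamma>)"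


text \<open>
  Real powers use the branch \<open>-\<pi> \<le> arg z < \<pi>\<close>. It differs from the principal branch of
  the library only on the negative real axis. There the choice is forced by the normalisation
  \<open>\<chi>(-I) = e\<^bsup>\<pi>iw\<^esup>\<close>: the consistency condition for \<open>(-I)(-I) = I\<close> reads
  \<open>\<chi>(-I)\<^sup>2 (-1)\<^bsup>2w\<^esup> = 1\<close>, which holds for every real \<open>w\<close> if \<open>arg (-1) = -\<pi>\<close>, and only for
  \<open>2w\<close> integral if \<open>arg (-1) = \<pi>\<close>.
\<close>

definition branch_arg :: "complex \<Rightarrow> real" where
  "branch_arg z = (if Arg z = pi then - pi else Arg z)"

definition rpow :: "complex \<Rightarrow> real \<Rightarrow> complex" where
  "rpow z w = of_real (norm z powr w) * cis (w * branch_arg z)"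

definition multiplier_system ::
    "real \<Rightarrow> (real^2^2) set \<Rightarrow> (real^2^2 \<Rightarrow> complex) \<Rightarrow> bool" where
  "multiplier_system w \<Gamma> chi \<longleftrightarrow>
     (\<forall>A\<in>\<Gamma>. norm (chi A) = 1) \<and>
     (\<forall>A\<in>\<Gamma>. \<forall>B\<in>\<Gamma>. \<forall>\<tau>\<in>\<H>.
        chi (A ** B) * rpow (aut_denom (A ** B) \<tau>) w =
        chi A * chi B * rpow (aut_denom A (act B \<tau>)) w * rpow (aut_denom B \<tau>) w) \<and>
     (- mat 1 \<in> \<Gamma> \<longrightarrow> chi (- mat 1) = cis (pi * w))"

definition unitary_group :: "(complex^'p^'p) monoid" where
  "unitary_group = \<lparr>carrier = {U. transpose (map_matrix cnj U) ** U = mat 1 \<and>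
                                  U ** transpose (map_matrix cnj U) = mat 1},
                    mult = (**), one = mat 1\<rparr>"

definition unitary_representation ::
    "(real^2^2) set \<Rightarrow> (real^2^2 \<Rightarrow> complex^'p^'p) \<Rightarrow> bool" where
  "unitary_representation \<Gamma> \<rho> \<longleftrightarrow> \<rho> \<in> hom (SL2R\<lparr>carrier := \<Gamma>\<rparr>) unitary_group"


text \<open>
  Functions on \<open>\<H>\<close> are represented by functions on the complex plane that vanish off \<open>\<H>\<close>, and
  families indexed by \<open>\<Gamma>\<close> by families that vanish off \<open>\<Gamma>\<close>, so that equality in the spaces
  below is equality on \<open>\<H>\<close> and on \<open>\<Gamma>\<close>.
\<close>

definition slash :: "real \<Rightarrow> (real^2^2 \<Rightarrow> complex) \<Rightarrow> (real^2^2 \<Rightarrow> complex^'p^'p) \<Rightarrow>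
    (complex \<Rightarrow> complex^'p) \<Rightarrow> real^2^2 \<Rightarrow> complex \<Rightarrow> complex^'p" where
  \<comment> \<open>the operator of weight \<open>-k\<close>\<close>
  "slash k chi \<rho> f A = (\<lambda>\<tau>. if \<tau> \<in> \<H>
     then (inverse (chi A) * rpow (aut_denom A \<tau>) k) *s (matrix_inv (\<rho> A) *v f (act A \<tau>))
     else 0)"

definition PP :: "(complex \<Rightarrow> complex^'p) set" where
  "PP = {G. (\<forall>\<tau>. \<tau> \<notin> \<H> \<longrightarrow> G \<tau> = 0) \<and>
            (\<forall>j. (\<lambda>\<tau>. G \<tau> $ j) holomorphic_on \<H>) \<and>
            (\<exists>K>0. \<exists>\<alpha>>0. \<exists>\<sigma>>0. \<forall>j. \<forall>\<tau>\<in>\<H>.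
               norm (G \<tau> $ j) < K * (norm \<tau> powr \<alpha> + Im \<tau> powr (- \<sigma>)))}"

definition cocycles :: "real \<Rightarrow> (real^2^2 \<Rightarrow> complex) \<Rightarrow> (real^2^2 \<Rightarrow> complex^'p^'p) \<Rightarrow>
    (real^2^2) set \<Rightarrow> (real^2^2 \<Rightarrow> complex \<Rightarrow> complex^'p) set" where
  "cocycles k chi \<rho> \<Gamma> =
     {g. (\<forall>A\<in>\<Gamma>. g A \<in> PP) \<and> (\<forall>A. A \<notin> \<Gamma> \<longrightarrow> g A = 0) \<and>
         (\<forall>A\<in>\<Gamma>. \<forall>B\<in>\<Gamma>. g (A ** B) = g B + slash k chi \<rho> (g A) B)}"

definition coboundaries :: "real \<Rightarrow> (real^2^2 \<Rightarrow> complex) \<Rightarrow> (real^2^2 \<Rightarrow> complex^'p^'p) \<Rightarrow>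
    (real^2^2) set \<Rightarrow> (real^2^2 \<Rightarrow> complex \<Rightarrow> complex^'p) set" where
  "coboundaries k chi \<rho> \<Gamma> =
     {g. (\<forall>A. A \<notin> \<Gamma> \<longrightarrow> g A = 0) \<and> (\<exists>p\<in>PP. \<forall>A\<in>\<Gamma>. g A = slash k chi \<rho> p A - p)}"

definition parabolic_cocycles :: "real \<Rightarrow> (real^2^2 \<Rightarrow> complex) \<Rightarrow>
    (real^2^2 \<Rightarrow> complex^'p^'p) \<Rightarrow> (real^2^2) set \<Rightarrow>
    (real^2^2 \<Rightarrow> complex \<Rightarrow> complex^'p) set" where
  "parabolic_cocycles k chi \<rho> \<Gamma> =
     {g \<in> cocycles k chi \<rho> \<Gamma>. \<forall>B\<in>\<Gamma>. parabolic B \<longrightarrow>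
        (\<exists>Q\<in>PP. g B = slash k chi \<rho> Q B - Q)}"

definition modulo :: "'a::minus set \<Rightarrow> 'a set \<Rightarrow> 'a set set" where
  "modulo Z B = Z // {(g, h). g \<in> Z \<and> h \<in> Z \<and> g - h \<in> B}"

definition H1 :: "real \<Rightarrow> (real^2^2 \<Rightarrow> complex) \<Rightarrow> (real^2^2 \<Rightarrow> complex^'p^'p) \<Rightarrow>
    (real^2^2) set \<Rightarrow> (real^2^2 \<Rightarrow> complex \<Rightarrow> complex^'p) set set" where
  "H1 k chi \<rho> \<Gamma> = modulo (cocycles k chi \<rho> \<Gamma>) (coboundaries k chi \<rho> \<Gamma>)"

definition H1_par :: "real \<Rightarrow> (real^2^2 \<Rightarrow> complex) \<Rightarrow> (real^2^2 \<Rightarrow> complex^'p^'p) \<Rightarrow>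
    (real^2^2) set \<Rightarrow> (real^2^2 \<Rightarrow> complex \<Rightarrow> complex^'p) set set" where
  "H1_par k chi \<rho> \<Gamma> = modulo (parabolic_cocycles k chi \<rho> \<Gamma>) (coboundaries k chi \<rho> \<Gamma>)"

end

theory Submission
  imports
    Defs
    "HOL-Computational_Algebra.Fundamental_Theorem_Algebra"
begin

text \<open>
  Conjugating a parabolic \<open>B\<close> to a translation, the equation \<open>Q|B - Q = g\<^sub>B\<close> becomes
  \<open>U f(z + h) - f(z) = g(z)\<close> with \<open>U\<close> unitary, to be solved with \<open>f\<close> of moderate growth, that is,
  bounded by a power of \<open>(1 + |z|\<^sup>2) / Im z\<close>. Since \<open>U\<close> is annihilated by a polynomial with roots
  of modulus one, this reduces to the scalar equation \<open>\<mu> f(z + 1) - f(z) = g(z)\<close>, \<open>|\<mu>| = 1\<close>.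

  With \<open>s(z) = 1 / (1 + exp(2\<pi>z))\<close>, a formal solution is
  \<open>-\<Sum>n\<ge>0. \<mu>\<^sup>n g(z + n) s(z + n) + \<Sum>n\<ge>1. \<mu>\<^sup>-\<^sup>n g(z - n) (1 - s(z - n))\<close>. Both sums converge
  exponentially, but the terms have poles at the translates of \<open>p\<^sub>k = i(k + 1/2)\<close>. The poles are
  cancelled by subtracting \<open>\<Sum>k. g(p\<^sub>k) K(z - p\<^sub>k)\<close>, where \<open>K\<close> solves the homogeneous equation, has
  simple poles at the integers and decays exponentially as \<open>Im z \<rightarrow> -\<infinity>\<close>. Near the cancelled
  poles the growth is controlled by the maximum principle. All estimates are made for
  \<open>|Re z| < 3/4\<close>; the equation itself then extends the solution to the half plane.
\<close>

subsection \<open>Functions of moderate growth\<close>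

text \<open>Summing \<open>\<mu>^n g(z + n)\<close> over n in one direction is hopeless, because g
  grows polynomially and the multiplier has modulus one. The partition 1 = s + (1 - s) gives each
  direction only the half of g that is exponentially small there; since s cannot be both holomorphic
  and decaying, poles are the price. The correction converges because the poles move upwards: for
  fixed z the imaginary part of z - p_k tends to minus infinity, and the decay of K there beats the
  polynomial growth of g(p_k). The rate of decay is 2 pi (1 - \<theta>) with \<open>\<mu>\<close> =
  exp(-2 pi i \<theta>), so \<theta> is taken to be a fractional part. Modulus one matters once more
  when the solution is carried from the strip to the half plane: the accumulated sums then have
  about |Re z| terms of moderate size, with no exponential factor. A matrix U enters only through
  the roots of an annihilating polynomial. Unitarity makes the factor of any root off the unit
  circle cancellable, so only scalar equations with unimodular multipliers remain. The bound by
  powers of \<open>hgt\<close> is equivalent to the growth condition of \<open>PP\<close>, but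
  unlike the latter it is visibly stable under real Moebius maps.\<close>

definition hgt :: "complex \<Rightarrow> real" where
  "hgt z = (1 + (norm z)\<^sup>2) / Im z"

definition moderate_on :: "complex set \<Rightarrow> (complex \<Rightarrow> complex) \<Rightarrow> bool" where
  "moderate_on S f \<longleftrightarrow> f holomorphic_on S \<and> (\<exists>K N. \<forall>z\<in>S. norm (f z) \<le> K * hgt z ^ N)"

lemma open_upper_half_plane: "open \<H>"
  using open_halfspace_Im_gt[of 0] by (simp add: greaterThan_def)

lemma hgt_bounds:
  assumes "Im z > 0"
  shows "2 \<le> hgt z" "Im z \<le> hgt z" "1 / Im z \<le> hgt z" "norm z \<le> hgt z" "\<bar>Re z\<bar> \<le> hgt z"
proof -
  have nz: "(norm z)\<^sup>2 = (Re z)\<^sup>2 + (Im z)\<^sup>2" by (simp add: cmod_power2)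
  have "2 * Im z \<le> 1 + (norm z)\<^sup>2"
    unfolding nz using sum_squares_bound[of 1 "Im z", simplified] zero_le_power2[of "Re z"] by linarith
  then show "2 \<le> hgt z" using assms by (simp add: hgt_def pos_le_divide_eq)
  have "Im z * Im z \<le> 1 + (norm z)\<^sup>2" unfolding nz by (simp add: power2_eq_square)
  then show "Im z \<le> hgt z" using assms by (simp add: hgt_def pos_le_divide_eq)
  show "1 / Im z \<le> hgt z"
    using assms by (simp add: hgt_def divide_right_mono)
  have "norm z * Im z \<le> norm z * norm z"
    by (intro mult_left_mono) (use abs_Im_le_cmod[of z] in auto)
  then have "norm z * Im z \<le> 1 + (norm z)\<^sup>2" by (simp add: power2_eq_square)
  then show "norm z \<le> hgt z" using assms by (simp add: hgt_def pos_le_divide_eq)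
  then show "\<bar>Re z\<bar> \<le> hgt z" using abs_Re_le_cmod[of z] by linarith
qed

lemma moderate_onI:
  assumes "f holomorphic_on S" "\<And>z. z \<in> S \<Longrightarrow> norm (f z) \<le> K * hgt z ^ N"
  shows "moderate_on S f"
  using assms unfolding moderate_on_def by blast

lemma moderate_onE:
  assumes "moderate_on S f" "S \<subseteq> \<H>"
  obtains K N where "f holomorphic_on S" "K > 0" "\<And>z M. z \<in> S \<Longrightarrow> N \<le> M \<Longrightarrow> norm (f z) \<le> K * hgt z ^ M"
proof -
  obtain K N where f: "f holomorphic_on S" and K: "\<And>z. z \<in> S \<Longrightarrow> norm (f z) \<le> K * hgt z ^ N"
    using assms unfolding moderate_on_def by blast
  have "norm (f z) \<le> (\<bar>K\<bar> + 1) * hgt z ^ M" if "z \<in> S" "N \<le> M" for z M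
  proof -
    have h: "hgt z \<ge> 2" using that assms hgt_bounds(1)[of z] by auto
    have "norm (f z) \<le> K * hgt z ^ N" by (rule K[OF that(1)])
    also have "\<dots> \<le> (\<bar>K\<bar> + 1) * hgt z ^ M"
      by (intro mult_mono power_increasing) (use h that in auto)
    finally show ?thesis .
  qed
  then show ?thesis using f that[of "\<bar>K\<bar> + 1" N] by simp
qed

lemma moderate_on_cong:
  assumes "moderate_on S f" "\<And>z. z \<in> S \<Longrightarrow> f z = g z"
  shows "moderate_on S g"
  using assms unfolding moderate_on_def by (metis holomorphic_transform)

lemma moderate_on_const: "moderate_on S (\<lambda>z. c)"
  by (rule moderate_onI[of _ _ "norm c" 0]) auto

lemma moderate_on_add:
  assumes "moderate_on S f" "moderate_on S g" "S \<subseteq> \<H>"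
  shows "moderate_on S (\<lambda>z. f z + g z)"
proof -
  obtain K N where f: "f holomorphic_on S" and K: "\<And>z M. z \<in> S \<Longrightarrow> N \<le> M \<Longrightarrow> norm (f z) \<le> K * hgt z ^ M"
    using moderate_onE[OF assms(1,3)] by metis
  obtain L M where g: "g holomorphic_on S" and L: "\<And>z N. z \<in> S \<Longrightarrow> M \<le> N \<Longrightarrow> norm (g z) \<le> L * hgt z ^ N"
    using moderate_onE[OF assms(2,3)] by metis
  show ?thesis
  proof (rule moderate_onI[of _ _ "K + L" "max N M"])
    show "(\<lambda>z. f z + g z) holomorphic_on S" by (intro holomorphic_intros f g)
    show "norm (f z + g z) \<le> (K + L) * hgt z ^ max N M" if "z \<in> S" for z
      using K[OF that, of "max N M"] L[OF that, of "max N M"] norm_triangle_ineq[of "f z" "g z"]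
      by (simp add: distrib_right)
  qed
qed

lemma moderate_on_mult:
  assumes "moderate_on S f" "moderate_on S g" "S \<subseteq> \<H>"
  shows "moderate_on S (\<lambda>z. f z * g z)"
proof -
  obtain K N where f: "f holomorphic_on S" "K > 0" and K: "\<And>z M. z \<in> S \<Longrightarrow> N \<le> M \<Longrightarrow> norm (f z) \<le> K * hgt z ^ M"
    using moderate_onE[OF assms(1,3)] by metis
  obtain L M where g: "g holomorphic_on S" and L: "\<And>z N. z \<in> S \<Longrightarrow> M \<le> N \<Longrightarrow> norm (g z) \<le> L * hgt z ^ N"
    using moderate_onE[OF assms(2,3)] by metis
  show ?thesis
  proof (rule moderate_onI[of _ _ "K * L" "N + M"])
    show "(\<lambda>z. f z * g z) holomorphic_on S" by (intro holomorphic_intros f g)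
    show "norm (f z * g z) \<le> (K * L) * hgt z ^ (N + M)" if "z \<in> S" for z
    proof -
      have "norm (f z) * norm (g z) \<le> (K * hgt z ^ N) * (L * hgt z ^ M)"
        by (intro mult_mono K L) (use that f hgt_bounds(1)[of z] assms(3) in auto)
      then show ?thesis by (simp add: norm_mult power_add mult_ac)
    qed
  qed
qed

lemma moderate_on_cmult: "moderate_on S f \<Longrightarrow> S \<subseteq> \<H> \<Longrightarrow> moderate_on S (\<lambda>z. c * f z)"
  using moderate_on_mult[OF moderate_on_const] .

lemma moderate_on_diff:
  "moderate_on S f \<Longrightarrow> moderate_on S g \<Longrightarrow> S \<subseteq> \<H> \<Longrightarrow> moderate_on S (\<lambda>z. f z - g z)"
  using moderate_on_add[of S f "\<lambda>z. -1 * g z"] moderate_on_cmult[of S g "-1"] by simp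

lemma moderate_on_sum:
  "(\<And>i. i \<in> I \<Longrightarrow> moderate_on S (f i)) \<Longrightarrow> S \<subseteq> \<H> \<Longrightarrow> moderate_on S (\<lambda>z. \<Sum>i\<in>I. f i z)"
  by (induction I rule: infinite_finite_induct) (auto intro: moderate_on_const moderate_on_add)

lemma Im_moebius_real:
  fixes a b c d :: real
  shows "Im ((of_real a * z + of_real b) / (of_real c * z + of_real d)) =
    (a * d - b * c) * Im z / (norm (of_real c * z + of_real d))\<^sup>2"
  by (simp add: Im_divide cmod_power2 field_simps)

lemma hgt_moebius_le:
  fixes a b c d :: real
  assumes "a * d - b * c > 0"
  obtains C where "C > 0"
    "\<And>z. Im z > 0 \<Longrightarrow> hgt ((of_real a * z + of_real b) / (of_real c * z + of_real d)) \<le> C * hgt z"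
    "\<And>z. Im z > 0 \<Longrightarrow> Im ((of_real a * z + of_real b) / (of_real c * z + of_real d)) > 0"
    "\<And>z. Im z > 0 \<Longrightarrow> of_real c * z + of_real d \<noteq> 0"
proof -
  define D where "D = a * d - b * c"
  define C where "C = 2 * (a\<^sup>2 + b\<^sup>2 + c\<^sup>2 + d\<^sup>2) / D + 1"
  have D: "D > 0" using assms by (simp add: D_def)
  have lin: "(norm (of_real x * z + of_real y))\<^sup>2 \<le> 2 * (x\<^sup>2 + y\<^sup>2) * (1 + (norm z)\<^sup>2)" for x y :: real and z :: complex
  proof -
    have "(norm (of_real x * z + of_real y))\<^sup>2 \<le> (\<bar>x\<bar> * norm z + \<bar>y\<bar>)\<^sup>2"
      using norm_triangle_ineq[of "of_real x * z" "of_real y"] by (intro power_mono) (auto simp: norm_mult)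
    also have "\<dots> \<le> 2 * ((\<bar>x\<bar> * norm z)\<^sup>2 + \<bar>y\<bar>\<^sup>2)"
      using sum_squares_bound[of "\<bar>x\<bar> * norm z" "\<bar>y\<bar>"] by (simp add: power2_sum)
    also have "\<dots> \<le> 2 * (x\<^sup>2 + y\<^sup>2) * (1 + (norm z)\<^sup>2)"
      by (simp add: algebra_simps power_mult_distrib)
    finally show ?thesis .
  qed
  have nz: "of_real c * z + of_real d \<noteq> 0" if "Im z > 0" for z
  proof
    assume 0: "of_real c * z + of_real d = 0"
    have "Im (of_real c * z + of_real d) = c * Im z" by simp
    then have "c = 0" using that 0 by simp
    then show False using 0 assms by simp
  qed
  have im: "Im ((of_real a * z + of_real b) / (of_real c * z + of_real d)) > 0" if "Im z > 0" for z
    unfolding Im_moebius_real using assms that nz[OF that] by simp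
  have "hgt ((of_real a * z + of_real b) / (of_real c * z + of_real d)) \<le> C * hgt z" if z: "Im z > 0" for z
  proof -
    define p where "p = (norm (of_real a * z + of_real b))\<^sup>2"
    define q where "q = (norm (of_real c * z + of_real d))\<^sup>2"
    have q: "q > 0" using nz[OF z] by (simp add: q_def)
    have "hgt ((of_real a * z + of_real b) / (of_real c * z + of_real d)) = (1 + p / q) / (D * Im z / q)"
      unfolding hgt_def Im_moebius_real p_def q_def D_def by (simp add: norm_divide power_divide)
    also have "\<dots> = (q + p) / (D * Im z)" using q D z by (simp add: field_simps)
    also have "\<dots> \<le> (2 * (c\<^sup>2 + d\<^sup>2) * (1 + (norm z)\<^sup>2) + 2 * (a\<^sup>2 + b\<^sup>2) * (1 + (norm z)\<^sup>2)) / (D * Im z)"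
      unfolding p_def q_def by (intro divide_right_mono add_mono lin) (use D z in auto)
    also have "\<dots> = (C - 1) * hgt z" using D z by (simp add: C_def hgt_def field_simps)
    also have "\<dots> \<le> C * hgt z" using hgt_bounds(1)[OF z] by simp
    finally show ?thesis .
  qed
  moreover have "C > 0" unfolding C_def using D by (intro add_nonneg_pos) auto
  ultimately show ?thesis using that[of C] im nz by blast
qed

lemma moderate_on_moebius:
  fixes a b c d :: real
  assumes "moderate_on S f" "S \<subseteq> \<H>" "T \<subseteq> \<H>" "a * d - b * c > 0"
    and "\<And>z. z \<in> T \<Longrightarrow> (of_real a * z + of_real b) / (of_real c * z + of_real d) \<in> S"
  shows "moderate_on T (\<lambda>z. f ((of_real a * z + of_real b) / (of_real c * z + of_real d)))"
proof -
  obtain C where C: "C > 0"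
    "\<And>z. Im z > 0 \<Longrightarrow> hgt ((of_real a * z + of_real b) / (of_real c * z + of_real d)) \<le> C * hgt z"
    "\<And>z. Im z > 0 \<Longrightarrow> Im ((of_real a * z + of_real b) / (of_real c * z + of_real d)) > 0"
    "\<And>z. Im z > 0 \<Longrightarrow> of_real c * z + of_real d \<noteq> 0"
    using hgt_moebius_le[OF assms(4)] by metis
  obtain K N where f: "f holomorphic_on S" "K > 0" and K: "\<And>z M. z \<in> S \<Longrightarrow> N \<le> M \<Longrightarrow> norm (f z) \<le> K * hgt z ^ M"
    using moderate_onE[OF assms(1,2)] by metis
  show ?thesis
  proof (rule moderate_onI[of _ _ "K * C ^ N" N])
    have "(\<lambda>z. (of_real a * z + of_real b) / (of_real c * z + of_real d)) holomorphic_on T"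
      using C(4) assms(3) by (intro holomorphic_intros) auto
    then show "(\<lambda>z. f ((of_real a * z + of_real b) / (of_real c * z + of_real d))) holomorphic_on T"
      using holomorphic_on_compose_gen[OF _ f(1), of _ T] assms(5) by (auto simp: o_def)
    fix z assume z: "z \<in> T"
    define w where "w = (of_real a * z + of_real b) / (of_real c * z + of_real d)"
    have imz: "Im z > 0" using z assms(3) by auto
    have w: "w \<in> S" "hgt w \<le> C * hgt z" "Im w > 0" using assms(5)[OF z] C(2,3)[OF imz] by (auto simp: w_def)
    have "norm (f w) \<le> K * hgt w ^ N" using K[OF w(1), of N] by simp
    also have "\<dots> \<le> K * (C * hgt z) ^ N"
      using f(2) w hgt_bounds(1)[OF w(3)] by (intro mult_left_mono power_mono) auto
    finally show "norm (f w) \<le> K * C ^ N * hgt z ^ N" by (simp add: power_mult_distrib mult_ac)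
  qed
qed

lemma moderate_on_translate:
  assumes "moderate_on S f" "S \<subseteq> \<H>" "T \<subseteq> \<H>" "\<And>z. z \<in> T \<Longrightarrow> z + of_real h \<in> S"
  shows "moderate_on T (\<lambda>z. f (z + of_real h))"
  using moderate_on_moebius[OF assms(1-3), of 1 1 h 0] assms(4) by simp

subsection \<open>Series of moderate growth\<close>

lemma power_le_exp:
  fixes a :: real
  assumes "a > 0"
  shows "\<exists>C>0. \<forall>t\<ge>0. (1 + t) ^ N \<le> C * exp (a * t)"
proof -
  \<comment> \<open>The rate is split so that N factors exp(b t) together stay below exp(a
    t).\<close>
  define b where "b = a / (real N + 1)"
  have b: "b > 0" using assms by (simp add: b_def)
  have "(1 + t) ^ N \<le> (1 + 1 / b) ^ N * exp (a * t)" if t: "t \<ge> 0" for t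
  proof -
    have "1 + t \<le> (1 + 1 / b) * (1 + b * t)" using b t by (simp add: field_simps)
    also have "\<dots> \<le> (1 + 1 / b) * exp (b * t)" using b by (intro mult_left_mono exp_ge_add_one_self) auto
    finally have "(1 + t) ^ N \<le> ((1 + 1 / b) * exp (b * t)) ^ N" using t by (intro power_mono) auto
    also have "\<dots> = (1 + 1 / b) ^ N * exp (real N * (b * t))"
      by (simp add: power_mult_distrib exp_of_nat_mult)
    also have "\<dots> \<le> (1 + 1 / b) ^ N * exp (a * t)"
    proof (intro mult_left_mono)
      have "real N * b \<le> a" using assms by (simp add: b_def field_simps)
      then have "real N * b * t \<le> a * t" using t by (intro mult_right_mono) auto
      then show "exp (real N * (b * t)) \<le> exp (a * t)" by (simp add: mult.assoc)
    qed (use b in auto)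
    finally show ?thesis .
  qed
  moreover have "(1 + 1 / b) ^ N > 0" using b by (intro zero_less_power add_pos_pos) auto
  ultimately show ?thesis by blast
qed

text \<open>Made for the kernel series: t is the index of a pole, v the height of z, and the maximum
  is the reciprocal of the decay of \<open>ker\<close>. Below height v the power is compared with
  that of v; above it, 1 + t is at most (1 + v)(1 + (t - v)) and the exponential absorbs the second
  factor.\<close>

lemma power_le_max_exp:
  fixes a :: real
  assumes "a > 0"
  shows "\<exists>C>0. \<forall>t\<ge>0. \<forall>v\<ge>0. (1 + t) ^ N \<le> C * (1 + v) ^ N * max 1 (exp (a * (t - v)))"
proof -
  obtain C where C: "C > 0" "\<And>t. t \<ge> 0 \<Longrightarrow> (1 + t) ^ N \<le> C * exp (a * t)"
    using power_le_exp[OF assms] by blast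
  have "(1 + t) ^ N \<le> (C + 1) * (1 + v) ^ N * max 1 (exp (a * (t - v)))" if tv: "t \<ge> 0" "v \<ge> 0" for t v
  proof (cases "t \<le> v")
    case True
    have "(1 + t) ^ N \<le> 1 * (1 + v) ^ N * 1" using True tv by (auto intro: power_mono)
    also have "\<dots> \<le> (C + 1) * (1 + v) ^ N * max 1 (exp (a * (t - v)))"
      using C(1) tv by (intro mult_mono) auto
    finally show ?thesis .
  next
    case False
    have "1 + t \<le> (1 + v) * (1 + (t - v))"
      using False tv mult_nonneg_nonneg[of v "t - v"] by (simp add: distrib_right distrib_left)
    then have "(1 + t) ^ N \<le> ((1 + v) * (1 + (t - v))) ^ N" using tv by (intro power_mono) auto
    also have "\<dots> \<le> (1 + v) ^ N * (C * exp (a * (t - v)))"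
      unfolding power_mult_distrib using C(2)[of "t - v"] False tv by (intro mult_left_mono) auto
    also have "\<dots> = C * (1 + v) ^ N * exp (a * (t - v))" by (simp only: mult_ac)
    also have "\<dots> \<le> (C + 1) * (1 + v) ^ N * max 1 (exp (a * (t - v)))"
      using C(1) tv by (intro mult_mono) auto
    finally show ?thesis .
  qed
  then show ?thesis using C(1) by (intro exI[of _ "C + 1"] conjI allI impI) auto
qed

text \<open>The M-test with majorants relative to a fixed power of \<open>hgt\<close>. Since
  \<open>hgt\<close> is bounded on closed discs in the half plane, convergence is locally uniform,
  and the same power bounds the sum.\<close>

lemma moderate_on_suminf:
  fixes T :: "nat \<Rightarrow> complex \<Rightarrow> complex"
  assumes "open S" "S \<subseteq> \<H>" and hol: "\<And>n. T n holomorphic_on S" and "summable a"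
    and bound: "\<And>n z. z \<in> S \<Longrightarrow> norm (T n z) \<le> a n * hgt z ^ N"
  shows "(\<lambda>z. \<Sum>n. T n z) holomorphic_on S"
    and "\<And>z. z \<in> S \<Longrightarrow> summable (\<lambda>n. T n z)"
    and "\<And>z. z \<in> S \<Longrightarrow> norm (\<Sum>n. T n z) \<le> suminf a * hgt z ^ N"
proof -
  have ab: "summable (\<lambda>n. a n * hgt z ^ N)" for z by (rule summable_mult2[OF assms(4)])
  show sm: "summable (\<lambda>n. T n z)" if "z \<in> S" for z
    by (rule summable_comparison_test'[OF ab[of z] bound[OF that]])
  show "norm (\<Sum>n. T n z) \<le> suminf a * hgt z ^ N" if "z \<in> S" for z
  proof -
    have "norm (\<Sum>n. T n z) \<le> (\<Sum>n. a n * hgt z ^ N)"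
      by (rule norm_suminf_le[OF bound[OF that] ab])
    then show ?thesis by (simp add: suminf_mult2[OF assms(4)])
  qed
  show "(\<lambda>z. \<Sum>n. T n z) holomorphic_on S"
  proof (rule holomorphic_uniform_sequence[OF assms(1), of "\<lambda>n z. \<Sum>i<n. T i z"])
    show "(\<lambda>z. \<Sum>i<n. T i z) holomorphic_on S" for n by (intro holomorphic_intros hol)
    fix z assume z: "z \<in> S"
    obtain d where d: "d > 0" "cball z d \<subseteq> S" using assms(1) z open_contains_cball by metis
    have "continuous_on (cball z d) hgt"
      unfolding hgt_def using d assms(2) by (intro continuous_intros) auto
    then have "bounded (hgt ` cball z d)"
      by (intro compact_imp_bounded compact_continuous_image) auto
    then obtain M where M: "\<And>w. w \<in> cball z d \<Longrightarrow> norm (hgt w) \<le> M"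
      unfolding bounded_iff by (meson imageI)
    have "uniform_limit (cball z d) (\<lambda>n w. \<Sum>i<n. T i w) (\<lambda>w. \<Sum>n. T n w) sequentially"
    proof (rule Weierstrass_m_test[of _ _ "\<lambda>n. a n * M ^ N"])
      show "norm (T n w) \<le> a n * M ^ N" if w: "w \<in> cball z d" for n w
      proof -
        have wS: "w \<in> S" using d w by blast
        then have h: "hgt w \<ge> 2" using assms(2) hgt_bounds(1) by blast
        have Mw: "hgt w \<le> M" using M[OF w] by simp
        \<comment> \<open>The sign of \<open>a n\<close> is not assumed; it is read off from the
          bound at a point of the disc.\<close>
        have "0 \<le> a n * hgt w ^ N" by (rule order_trans[OF norm_ge_zero bound[OF wS]])
        moreover have "hgt w ^ N > 0" using h by (intro zero_less_power) linarith
        ultimately have an: "0 \<le> a n" by (auto simp: zero_le_mult_iff)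
        have "norm (T n w) \<le> a n * hgt w ^ N" by (rule bound[OF wS])
        also have "\<dots> \<le> a n * M ^ N" using an h Mw by (intro mult_left_mono power_mono) auto
        finally show ?thesis .
      qed
      show "summable (\<lambda>n. a n * M ^ N)" by (rule summable_mult2[OF assms(4)])
    qed
    then show "\<exists>d>0. cball z d \<subseteq> S \<and>
        uniform_limit (cball z d) (\<lambda>n w. \<Sum>i<n. T i w) (\<lambda>w. \<Sum>n. T n w) sequentially"
      using d by blast
  qed
qed

text \<open>The half-width 3/4 lies between 1/2 and 1. Above 1/2, integer translates of the strip
  overlap and cover the half plane; below 1, the poles \<open>pl k\<close> shifted by a nonzero
  integer stay outside.\<close>

definition strip :: "complex set" where
  "strip = {z. \<bar>Re z\<bar> < 3/4 \<and> Im z > 0}"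

lemma open_strip: "open strip"
proof -
  have "strip = {z. -(3/4) < Re z} \<inter> {z. Re z < 3/4} \<inter> {z. Im z > 0}"
    by (auto simp: strip_def)
  moreover have "open \<dots>"
    by (intro open_Int open_halfspace_Re_gt open_halfspace_Re_lt open_halfspace_Im_gt)
  ultimately show ?thesis by simp
qed

lemma strip_subset: "strip \<subseteq> \<H>"
  by (auto simp: strip_def)

lemma hgt_add_real_le:
  assumes "Im z > 0"
  shows "hgt (z + of_real m) \<le> 2 * (1 + \<bar>m\<bar>)\<^sup>2 * hgt z"
proof -
  have "(norm (z + of_real m))\<^sup>2 \<le> (norm z + \<bar>m\<bar>)\<^sup>2"
    using norm_triangle_ineq[of z "of_real m"] by (intro power_mono) auto
  also have "\<dots> \<le> 2 * (norm z)\<^sup>2 + 2 * \<bar>m\<bar>\<^sup>2"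
    using sum_squares_bound[of "norm z" "\<bar>m\<bar>"] by (simp add: power2_sum)
  finally have "1 + (norm (z + of_real m))\<^sup>2 \<le> 2 * (1 + \<bar>m\<bar>\<^sup>2) * (1 + (norm z)\<^sup>2)"
    using zero_le_power2[of "m * norm z"] unfolding power_mult_distrib power2_abs distrib_left distrib_right
    by linarith
  also have "\<dots> \<le> 2 * (1 + \<bar>m\<bar>)\<^sup>2 * (1 + (norm z)\<^sup>2)"
    by (intro mult_mono) (auto simp: power2_sum)
  finally show ?thesis using assms by (simp add: hgt_def divide_right_mono)
qed

lemma exp_half_pi_ge_2: "exp (pi / 2) \<ge> (2::real)"
  using exp_ge_add_one_self[of "pi / 2"] pi_gt3 by linarith

text \<open>The term without a translation is left out because it has poles in the strip.\<close>

lemma translate_sum_moderate: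
  fixes e :: real
  assumes g: "moderate_on \<H> g" and e: "\<bar>e\<bar> = 1" and c: "\<And>n. norm (c n) = 1"
  defines "T \<equiv> \<lambda>n z. c n * g (z + of_real (e * real (Suc n))) / (1 + exp (of_real (2 * pi) * (of_real e * z + of_nat (Suc n))))"
  shows "moderate_on strip (\<lambda>z. \<Sum>n. T n z)" and "\<And>z. z \<in> strip \<Longrightarrow> summable (\<lambda>n. T n z)"
proof -
  obtain K N where gh: "g holomorphic_on \<H>" "K > 0" and K: "\<And>z M. z \<in> \<H> \<Longrightarrow> N \<le> M \<Longrightarrow> norm (g z) \<le> K * hgt z ^ M"
    using moderate_onE[OF g order_refl] by metis
  obtain C :: real where C: "C > 0" "\<forall>t\<ge>0. (1 + t) ^ (2 * N) \<le> C * exp (1 * t)"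
    using power_le_exp[OF zero_less_one, of "2 * N"] by blast
  \<comment> \<open>With m = n + 1, the shift costs (1 + m)^(2N), at most C exp(m), while the
    denominator is at least exp(2 pi (m - 3/4)) / 2. As 2 pi exceeds 2, what remains is at most 2 C
    exp(3 pi / 2) exp(-m).\<close>
  define a where "a n = K * 2 ^ N * C * 2 * exp (3 * pi / 2) * exp (- 1) ^ Suc n" for n :: nat
  have "summable (\<lambda>n. exp (- 1 :: real) ^ Suc n)"
    using summable_geometric[of "exp (- 1 :: real)"] by (subst summable_Suc_iff) simp
  then have sa: "summable a" unfolding a_def by (rule summable_mult)
  \<comment> \<open>In the strip the exponent has real part at least 2 pi (1 - 3/4) = pi / 2, so the
    exponential has modulus at least 2 and adding 1 loses at most half of it.\<close>
  have den: "norm (1 + exp (of_real (2 * pi) * (of_real e * z + of_nat (Suc n)))) \<ge> exp (2 * pi * (real (Suc n) - 3/4)) / 2"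
    if z: "z \<in> strip" for z n
  proof -
    define r where "r = 2 * pi * (e * Re z + real (Suc n))"
    have "\<bar>e * Re z\<bar> < 3/4" using z e by (simp add: strip_def abs_mult)
    then have "e * Re z + real (Suc n) \<ge> real (Suc n) - 3/4" by linarith
    then have r: "r \<ge> 2 * pi * (real (Suc n) - 3/4)" unfolding r_def by (intro mult_left_mono) auto
    have "2 * pi * (1/4) \<le> 2 * pi * (real (Suc n) - 3/4)" by (intro mult_left_mono) auto
    then have "pi / 2 \<le> r" using r by linarith
    then have r2: "exp r \<ge> 2" by (intro order_trans[OF exp_half_pi_ge_2]) simp
    have "norm (exp (of_real (2 * pi) * (of_real e * z + of_nat (Suc n)))) = exp r"
      by (simp add: norm_exp_eq_Re r_def)
    then have "norm (1 + exp (of_real (2 * pi) * (of_real e * z + of_nat (Suc n)))) \<ge> exp r - 1"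
      using norm_triangle_ineq4[of "1 + exp (of_real (2 * pi) * (of_real e * z + of_nat (Suc n)))" 1] by simp
    moreover have "exp r - 1 \<ge> exp r / 2" using r2 by simp
    moreover have "exp r \<ge> exp (2 * pi * (real (Suc n) - 3/4))" using r by simp
    ultimately show ?thesis by linarith
  qed
  have hol: "T n holomorphic_on strip" for n
  proof -
    have "(\<lambda>z. g (z + of_real (e * real (Suc n)))) holomorphic_on strip"
      using moderate_on_translate[OF g order_refl strip_subset, of "e * real (Suc n)"]
      by (auto simp: strip_def moderate_on_def)
    moreover have "1 + exp (of_real (2 * pi) * (of_real e * z + of_nat (Suc n))) \<noteq> 0" if "z \<in> strip" for z
    proof
      assume "1 + exp (of_real (2 * pi) * (of_real e * z + of_nat (Suc n))) = 0"
      then have "exp (2 * pi * (real (Suc n) - 3/4)) / 2 \<le> 0" using den[OF that, of n] by (simp only: norm_zero)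
      then show False using exp_gt_zero[of "2 * pi * (real (Suc n) - 3/4)"] by linarith
    qed
    ultimately show ?thesis unfolding T_def by (intro holomorphic_intros) auto
  qed
  have bound: "norm (T n z) \<le> a n * hgt z ^ N" if z: "z \<in> strip" for n z
  proof -
    define m where "m = real (Suc n)"
    have im: "Im z > 0" using z by (simp add: strip_def)
    have em: "\<bar>e * m\<bar> = m" using e by (simp add: abs_mult m_def)
    have h2: "hgt z \<ge> 2" "hgt (z + of_real (e * m)) \<ge> 2"
      using hgt_bounds(1)[of z] hgt_bounds(1)[of "z + of_real (e * m)"] im by auto
    have "norm (g (z + of_real (e * m))) \<le> K * hgt (z + of_real (e * m)) ^ N" using K[of "z + of_real (e * m)" N] im by simp
    also have "\<dots> \<le> K * (2 * (1 + m)\<^sup>2 * hgt z) ^ N"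
      using hgt_add_real_le[OF im, of "e * m"] em gh h2 by (intro mult_left_mono power_mono) auto
    also have "\<dots> = K * 2 ^ N * (1 + m) ^ (2 * N) * hgt z ^ N"
      by (simp add: power_mult_distrib power_mult)
    also have "\<dots> \<le> K * 2 ^ N * (C * exp (1 * m)) * hgt z ^ N"
      using C(2)[rule_format, of m] gh h2 by (intro mult_right_mono mult_left_mono) (auto simp: m_def)
    finally have gb: "norm (g (z + of_real (e * m))) \<le> K * 2 ^ N * (C * exp m) * hgt z ^ N" by simp
    define E where "E = exp (2 * pi * (m - 3/4))"
    have E: "E > 0" by (simp add: E_def)
    have "norm (T n z) = norm (g (z + of_real (e * m))) / norm (1 + exp (of_real (2 * pi) * (of_real e * z + of_nat (Suc n))))"
      unfolding T_def m_def by (simp only: norm_divide norm_mult c mult_1)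
    also have "\<dots> \<le> (K * 2 ^ N * (C * exp m) * hgt z ^ N) / (E / 2)"
    proof (rule frac_le)
      show "E / 2 \<le> norm (1 + exp (of_real (2 * pi) * (of_real e * z + of_nat (Suc n))))"
        unfolding E_def m_def by (rule den[OF z])
    qed (use gb E gh C h2 in auto)
    also have "\<dots> = K * 2 ^ N * C * 2 * (exp m * exp (- (2 * pi * (m - 3/4)))) * hgt z ^ N"
      unfolding exp_minus E_def[symmetric] using E by (simp add: field_simps)
    also have "\<dots> \<le> K * 2 ^ N * C * 2 * (exp (3 * pi / 2) * exp (- 1) ^ Suc n) * hgt z ^ N"
    proof -
      have "m * 2 \<le> m * (2 * pi)" using pi_gt3 by (intro mult_left_mono) (auto simp: m_def)
      then have "m - 2 * pi * (m - 3/4) \<le> 3 * pi / 2 - m" by (simp add: algebra_simps)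
      then have "exp m * exp (- (2 * pi * (m - 3/4))) \<le> exp (3 * pi / 2) * exp (- m)"
        unfolding exp_add[symmetric] exp_le_cancel_iff by linarith
      also have "exp (- m) = exp (- 1) ^ Suc n" unfolding exp_of_nat_mult[symmetric] by (simp add: m_def)
      finally have le: "exp m * exp (- (2 * pi * (m - 3/4))) \<le> exp (3 * pi / 2) * exp (- 1) ^ Suc n" .
      show ?thesis by (intro mult_right_mono[OF mult_left_mono[OF le]]) (use gh C h2 in auto)
    qed
    finally show ?thesis by (simp only: a_def mult.assoc)
  qed
  show "moderate_on strip (\<lambda>z. \<Sum>n. T n z)"
    by (rule moderate_onI; rule moderate_on_suminf[OF open_strip strip_subset hol sa bound])
  show "summable (\<lambda>n. T n z)" if "z \<in> strip" for z
    by (rule moderate_on_suminf(2)[OF open_strip strip_subset hol sa bound that])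
qed

subsection \<open>The correction of the poles\<close>

text \<open>A solution of the homogeneous equation with a simple pole of residue \<open>1 / (2\<pi>)\<close> at the
  integers, bounded far above the real axis and exponentially decaying far below it.\<close>

definition ker :: "real \<Rightarrow> complex \<Rightarrow> complex" where
  "ker \<theta> u = \<i> * exp (of_real (2 * pi * \<theta>) * \<i> * u) / (exp (of_real (2 * pi) * \<i> * u) - 1)"

definition pl :: "nat \<Rightarrow> complex" where
  "pl k = Complex 0 (real k + 1/2)"

text \<open>A slice of the strip that contains the single pole \<open>pl k\<close> and stays at
  vertical distance 1/4 from all others. Consecutive slices overlap, and together they cover the
  strip.\<close>

definition window :: "nat \<Rightarrow> complex set" where
  "window k = {z \<in> strip. \<bar>Im z - (real k + 1/2)\<bar> < 3/4}"

lemma ker_add_1: "exp (- (of_real (2 * pi * \<theta>) * \<i>)) * ker \<theta> (u + 1) = ker \<theta> u"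
proof -
  have "exp (of_real (2 * pi) * \<i> * (u + 1)) = exp (of_real (2 * pi) * \<i> * u)"
    by (simp add: distrib_left exp_add)
  moreover have "exp (- (of_real (2 * pi * \<theta>) * \<i>)) * exp (of_real (2 * pi * \<theta>) * \<i> * (u + 1)) =
      exp (of_real (2 * pi * \<theta>) * \<i> * u)"
    unfolding exp_add[symmetric] by (simp add: distrib_left)
  ultimately show ?thesis unfolding ker_def by (simp add: mult.left_commute)
qed

text \<open>Put q = exp(2 pi i u). At distance 1/4 from the real axis |q| is at most 1/2 or at least
  2, so the denominator q - 1 is comparable to 1 above the axis and to q below it. Below, dividing
  by |q| turns the numerator into a decay of rate 2 pi (1 - \<theta>), which the maximum in the
  statement exactly compensates.\<close>

lemma norm_ker_le:
  assumes "0 \<le> \<theta>" "\<theta> < 1" "\<bar>Im u\<bar> \<ge> 1/4"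
  shows "norm (ker \<theta> u) * max 1 (exp (2 * pi * (1 - \<theta>) * (- Im u))) \<le> 2"
proof -
  define y where "y = Im u"
  define q where "q = exp (of_real (2 * pi) * \<i> * u)"
  have nq: "norm q = exp (- (2 * pi * y))" by (simp add: q_def norm_exp_eq_Re y_def)
  have nk: "norm (ker \<theta> u) = exp (- (2 * pi * \<theta> * y)) / norm (q - 1)"
    unfolding ker_def q_def y_def by (simp add: norm_divide norm_mult norm_exp_eq_Re)
  show ?thesis
  proof (cases "y \<ge> 0")
    case True
    then have y: "y \<ge> 1/4" using assms by (simp add: y_def)
    have "2 * pi * (1/4) \<le> 2 * pi * y" using y by (intro mult_left_mono) auto
    then have "exp (pi / 2) \<le> exp (2 * pi * y)" by simp
    then have "2 \<le> exp (2 * pi * y)" using exp_half_pi_ge_2 by linarith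
    then have "norm q \<le> 1/2" unfolding nq exp_minus by (simp add: field_simps)
    then have q1: "norm (q - 1) \<ge> 1/2" using norm_triangle_ineq2[of 1 q] by (simp add: norm_minus_commute)
    have "exp (- (2 * pi * \<theta> * y)) \<le> 1" using True assms by simp
    then have "norm (ker \<theta> u) \<le> 1 / (1/2)" unfolding nk using q1 by (intro frac_le) auto
    moreover have "exp (2 * pi * (1 - \<theta>) * (- Im u)) \<le> 1" using True assms by (simp add: y_def mult_le_0_iff)
    ultimately show ?thesis by simp
  next
    case False
    then have y: "y \<le> -1/4" using assms by (simp add: y_def)
    have "2 * pi * (1/4) \<le> 2 * pi * (-y)" using y by (intro mult_left_mono) auto
    then have "exp (pi / 2) \<le> exp (- (2 * pi * y))" by simp
    then have q2: "2 \<le> norm q" unfolding nq using exp_half_pi_ge_2 by linarith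
    then have q1: "norm (q - 1) \<ge> norm q / 2" using norm_triangle_ineq2[of q 1] by simp
    have "0 \<le> 2 * pi * (1 - \<theta>) * (- y)" using False assms by (intro mult_nonneg_nonneg) auto
    then have "1 \<le> exp (2 * pi * (1 - \<theta>) * (- y))" by (simp only: one_le_exp_iff)
    then have m: "max 1 (exp (2 * pi * (1 - \<theta>) * (- Im u))) = exp (2 * pi * (1 - \<theta>) * (- y))"
      unfolding y_def by (rule max_absorb2)
    have "norm (ker \<theta> u) \<le> exp (- (2 * pi * \<theta> * y)) / (norm q / 2)"
      unfolding nk using q1 q2 by (intro frac_le) auto
    also have "\<dots> = 2 * exp (- (2 * pi * \<theta> * y) - (- (2 * pi * y)))"
      unfolding nq exp_diff by simp
    finally have "norm (ker \<theta> u) * exp (2 * pi * (1 - \<theta>) * (- y)) \<le>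
      2 * exp (- (2 * pi * \<theta> * y) - (- (2 * pi * y))) * exp (2 * pi * (1 - \<theta>) * (- y))"
      by (intro mult_right_mono) auto
    also have "\<dots> = 2 * exp (- (2 * pi * \<theta> * y) - (- (2 * pi * y)) + 2 * pi * (1 - \<theta>) * (- y))"
      by (simp only: exp_add mult.assoc)
    also have "- (2 * pi * \<theta> * y) - (- (2 * pi * y)) + 2 * pi * (1 - \<theta>) * (- y) = 0"
      by (simp add: algebra_simps)
    finally show ?thesis unfolding m by simp
  qed
qed

lemma open_window: "open (window k)"
proof -
  have "window k = strip \<inter> {z. real k + 1/2 - 3/4 < Im z} \<inter> {z. Im z < real k + 1/2 + 3/4}"
    unfolding window_def abs_less_iff by (auto simp: algebra_simps)
  moreover have "open \<dots>"
    by (intro open_Int open_strip open_halfspace_Im_gt open_halfspace_Im_lt)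
  ultimately show ?thesis by simp
qed

lemma window_subset: "window k \<subseteq> \<H>"
  using strip_subset by (auto simp: window_def)

lemma hgt_pl_le: "hgt (pl k) \<le> 3 * (1 + real k)"
proof -
  define t where "t = real k + 1/2"
  have t: "t \<ge> 1/2" by (simp add: t_def)
  have "hgt (pl k) = (1 + t * t) / t" by (simp add: hgt_def pl_def cmod_def t_def power2_eq_square)
  also have "\<dots> = 1 / t + t" using t by (simp add: field_simps)
  also have "1 / t \<le> 2" using t by (simp add: field_simps)
  finally show ?thesis by (simp add: t_def)
qed

lemma exp_2pi_i_eq_1_iff: "exp (of_real (2 * pi) * \<i> * u) = 1 \<longleftrightarrow> (\<exists>n::int. u = of_int n)"
proof -
  have "exp (of_real (2 * pi) * \<i> * u) = 1 \<longleftrightarrow> (Im u = 0 \<and> (\<exists>n::int. Re u = of_int n))"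
    by (simp add: exp_eq_1)
  also have "\<dots> \<longleftrightarrow> (\<exists>n::int. u = of_int n)" by (auto simp: complex_eq_iff)
  finally show ?thesis .
qed

lemma ker_holomorphic:
  assumes "\<And>z n. z \<in> S \<Longrightarrow> z - a \<noteq> of_int n"
  shows "(\<lambda>z. ker \<theta> (z - a)) holomorphic_on S"
proof -
  have "exp (of_real (2 * pi) * \<i> * (z - a)) - 1 \<noteq> 0" if "z \<in> S" for z
    using assms[OF that] exp_2pi_i_eq_1_iff[of "z - a"] by auto
  then show ?thesis unfolding ker_def by (intro holomorphic_intros) auto
qed

lemma window_Im_pl:
  assumes "z \<in> window k" "j \<noteq> k"
  shows "\<bar>Im (z - pl j)\<bar> \<ge> 1/4"
proof -
  have "\<bar>real j - real k\<bar> \<ge> 1" using assms(2) by linarith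
  moreover have "Im (z - pl j) = (Im z - (real k + 1/2)) - (real j - real k)" by (simp add: pl_def)
  moreover have "\<bar>Im z - (real k + 1/2)\<bar> < 3/4" using assms(1) by (simp add: window_def)
  ultimately show ?thesis by linarith
qed

text \<open>In each window the one term with a pole there is replaced by 0, which makes the rest of
  the series holomorphic. The constants must not depend on k, since the windows are later glued into
  one function on the strip.\<close>

lemma kernel_sum_moderate:
  assumes g: "moderate_on \<H> g" and \<theta>: "0 \<le> \<theta>" "\<theta> < 1"
  defines "T \<equiv> \<lambda>k n z. if n = k then 0 else g (pl n) * ker \<theta> (z - pl n)"
  shows "\<exists>C N. \<forall>k. (\<lambda>z. \<Sum>n. T k n z) holomorphic_on window k \<and>
    (\<forall>z\<in>window k. summable (\<lambda>n. T k n z) \<and> norm (\<Sum>n. T k n z) \<le> C * hgt z ^ N)"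
proof -
  obtain K N where gh: "g holomorphic_on \<H>" "K > 0" and K: "\<And>z M. z \<in> \<H> \<Longrightarrow> N \<le> M \<Longrightarrow> norm (g z) \<le> K * hgt z ^ M"
    using moderate_onE[OF g order_refl] by metis
  define b where "b = 2 * pi * (1 - \<theta>)"
  have "b > 0" using \<theta> by (simp add: b_def)
  then obtain C where C: "C > 0"
    \<comment> \<open>N powers pay for the growth of \<open>g (pl n)\<close>; the two extra ones
      leave the summable factor 1 / (1 + n)^2.\<close>
    "\<forall>t\<ge>0. \<forall>v\<ge>0. (1 + t) ^ (N + 2) \<le> C * (1 + v) ^ (N + 2) * max 1 (exp (b * (t - v)))"
    using power_le_max_exp by blast
  define a where "a n = K * 3 ^ N * (2 * C * 2 ^ (N + 2)) * (1 / (1 + real n)\<^sup>2)" for n :: nat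
  have "summable (\<lambda>n. inverse ((real (Suc n))\<^sup>2))"
    using inverse_power_summable[of 2, where 'a = real] by (subst summable_Suc_iff) auto
  then have "summable (\<lambda>n. 1 / (1 + real n)\<^sup>2)" by (simp add: inverse_eq_divide add.commute)
  then have sa: "summable a" unfolding a_def by (rule summable_mult)
  have hol: "T k n holomorphic_on window k" for k n
  proof (cases "n = k")
    case False
    have "(\<lambda>z. ker \<theta> (z - pl n)) holomorphic_on window k"
    proof (rule ker_holomorphic)
      show "z - pl n \<noteq> of_int m" if "z \<in> window k" for z m
      proof
        assume "z - pl n = of_int m"
        then have "Im (z - pl n) = 0" by (simp only: complex_Im_of_int)
        then show False using window_Im_pl[OF that False] by linarith
      qed
    qed
    then show ?thesis using False by (simp add: T_def holomorphic_intros)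
  qed (simp add: T_def)
  have bound: "norm (T k n z) \<le> a n * hgt z ^ (N + 2)" if z: "z \<in> window k" for k n z
  proof (cases "n = k")
    case False
    have im: "Im z > 0" using z window_subset by auto
    have h: "hgt z \<ge> 2" by (rule hgt_bounds(1)[OF im])
    define t where "t = real n"
    define m where "m = max 1 (exp (b * (t - Im z)))"
    have m: "m > 0" by (simp add: m_def)
    have "norm (ker \<theta> (z - pl n)) * m \<le> norm (ker \<theta> (z - pl n)) * max 1 (exp (b * (- Im (z - pl n))))"
    proof (intro mult_left_mono)
      have "b * (t - Im z) \<le> b * (- Im (z - pl n))"
        using \<open>b > 0\<close> by (intro mult_left_mono) (auto simp: t_def pl_def)
      then show "m \<le> max 1 (exp (b * (- Im (z - pl n))))" unfolding m_def by (intro max.mono) auto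
    qed auto
    also have "\<dots> \<le> 2" unfolding b_def using norm_ker_le[OF \<theta> window_Im_pl[OF z False]] .
    finally have k2: "norm (ker \<theta> (z - pl n)) \<le> 2 / m" using m by (simp add: pos_le_divide_eq)
    have "(1 + t) ^ (N + 2) \<le> C * (1 + Im z) ^ (N + 2) * m"
      using C(2)[rule_format, of t "Im z"] im by (simp add: t_def m_def)
    also have "\<dots> \<le> C * (2 * hgt z) ^ (N + 2) * m"
      using C m im h hgt_bounds(2)[OF im] by (intro mult_right_mono mult_left_mono power_mono) auto
    finally have "(1 + t) ^ N * (1 + t)\<^sup>2 \<le> C * (2 * hgt z) ^ (N + 2) * m" by (simp only: power_add)
    then have tm: "(1 + t) ^ N / m \<le> C * (2 * hgt z) ^ (N + 2) / (1 + t)\<^sup>2"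
      using m by (simp add: t_def divide_simps mult_ac)
    have "norm (g (pl n)) \<le> K * hgt (pl n) ^ N" using K[of "pl n" N] by (simp add: pl_def)
    also have "\<dots> \<le> K * (3 * (1 + t)) ^ N"
      using gh hgt_pl_le[of n] hgt_bounds(1)[of "pl n"] unfolding t_def
      by (intro mult_left_mono power_mono) (auto simp: pl_def)
    finally have "norm (g (pl n)) \<le> K * (3 * (1 + t)) ^ N" .
    then have "norm (T k n z) \<le> K * (3 * (1 + t)) ^ N * (2 / m)"
      using False k2 gh unfolding T_def by (simp only: if_False norm_mult) (intro mult_mono, auto simp: t_def)
    also have "\<dots> = K * 3 ^ N * 2 * ((1 + t) ^ N / m)" unfolding power_mult_distrib by simp
    also have "\<dots> \<le> K * 3 ^ N * 2 * (C * (2 * hgt z) ^ (N + 2) / (1 + t)\<^sup>2)"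
      using gh by (intro mult_left_mono tm) auto
    also have "\<dots> = a n * hgt z ^ (N + 2)"
      unfolding a_def t_def power_mult_distrib by simp
    finally show ?thesis .
  next
    case True
    have "hgt z \<ge> 2" using z window_subset hgt_bounds(1) by blast
    then show ?thesis using True gh C by (simp add: T_def a_def)
  qed
  have "(\<lambda>z. \<Sum>n. T k n z) holomorphic_on window k" for k
    by (rule moderate_on_suminf(1)[OF open_window window_subset hol sa bound])
  moreover have "summable (\<lambda>n. T k n z)" if "z \<in> window k" for k z
    by (rule moderate_on_suminf(2)[OF open_window window_subset hol sa bound that])
  moreover have "norm (\<Sum>n. T k n z) \<le> suminf a * hgt z ^ (N + 2)" if "z \<in> window k" for k z
    by (rule moderate_on_suminf(3)[OF open_window window_subset hol sa bound that])
  ultimately show ?thesis by blast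
qed

section \<open>Removing a single pole, uniformly in its index\<close>

lemma exp_2pi_pl: "exp (of_real (2 * pi) * pl k) = -1"
proof -
  have "of_real (2 * pi) * pl k = \<i> * of_real (2 * pi * real k + pi)"
    by (simp add: complex_eq_iff pl_def algebra_simps)
  then have "exp (of_real (2 * pi) * pl k) = cis (2 * pi * real k + pi)" by (simp add: cis_conv_exp)
  also have "\<dots> = cis (2 * pi * real k) * cis pi" by (rule cis_mult[symmetric])
  also have "cis (2 * pi * real k) = 1" by (intro cis_multiple_2pi) simp
  also have "1 * cis pi = -1" by simp
  finally show ?thesis .
qed

lemma one_plus_exp_eq_0_iff:
  "1 + exp (of_real (2 * pi) * z) = 0 \<longleftrightarrow> Re z = 0 \<and> (\<exists>n::int. Im z = of_int n + 1/2)"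
proof -
  have "exp (of_real (2 * pi) * (z - pl 0)) = - exp (of_real (2 * pi) * z)"
    unfolding right_diff_distrib exp_diff exp_2pi_pl by simp
  then have "1 + exp (of_real (2 * pi) * z) = 0 \<longleftrightarrow> exp (of_real (2 * pi) * (z - pl 0)) = 1"
    by (metis add.commute eq_neg_iff_add_eq_0 minus_equation_iff)
  also have "\<dots> \<longleftrightarrow> Re z = 0 \<and> (\<exists>n::int. Im z - 1/2 = of_int n)"
    unfolding exp_eq_1 by (simp add: pl_def)
  also have "\<dots> \<longleftrightarrow> Re z = 0 \<and> (\<exists>n::int. Im z = of_int n + 1/2)" by (simp add: algebra_simps)
  finally show ?thesis .
qed

text \<open>The closed rectangle of a window recentred at its pole, without a disc about the pole.
  Periodicity moves every window to this one compact set, which is why the bounds below do not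
  depend on k.\<close>

definition frame :: "complex set" where
  "frame = {u. \<bar>Re u\<bar> \<le> 3/4 \<and> \<bar>Im u\<bar> \<le> 3/4 \<and> 1/4 \<le> norm u}"

lemma compact_frame: "compact frame"
proof -
  have "frame = {u. \<bar>Re u\<bar> \<le> 3/4} \<inter> {u. \<bar>Im u\<bar> \<le> 3/4} \<inter> {u. 1/4 \<le> norm u}"
    by (auto simp: frame_def)
  moreover have "closed \<dots>"
    by (intro closed_Int closed_Collect_le continuous_intros)
  moreover have "bounded frame"
  proof -
    have "norm u \<le> 3/2" if "u \<in> frame" for u
      using cmod_le[of u] that by (simp add: frame_def)
    then show ?thesis unfolding bounded_iff by blast
  qed
  ultimately show ?thesis by (simp add: compact_eq_bounded_closed)
qed

lemma frame_bounds:
  "\<exists>B>0. \<forall>u\<in>frame. norm (ker \<theta> u) \<le> B \<and> norm (1 / (1 - exp (of_real (2 * pi) * u))) \<le> B"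
proof -
  have 1: "u \<noteq> of_int n" if "u \<in> frame" for u n
  proof
    assume u: "u = of_int n"
    then have "\<bar>n\<bar> < 1" using that by (auto simp: frame_def)
    then show False using that u by (simp add: frame_def)
  qed
  have "(\<lambda>u. ker \<theta> (u - 0)) holomorphic_on frame" by (rule ker_holomorphic) (use 1 in simp)
  then have "continuous_on frame (ker \<theta>)" by (auto intro: holomorphic_on_imp_continuous_on)
  then have "bounded (ker \<theta> ` frame)"
    using compact_frame by (intro compact_imp_bounded compact_continuous_image)
  then obtain B1 where B1: "B1 > 0" "\<forall>x\<in>ker \<theta> ` frame. norm x \<le> B1" unfolding bounded_pos by blast
  have 2: "1 - exp (of_real (2 * pi) * u) \<noteq> 0" if "u \<in> frame" for u
  proof
    assume "1 - exp (of_real (2 * pi) * u) = 0"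
    then have "exp (of_real (2 * pi) * u) = 1" by simp
    then obtain n :: int where n: "Re u = 0" "Im u = of_int n"
      unfolding exp_eq_1 by auto
    then have "\<bar>n\<bar> < 1" using that by (auto simp: frame_def)
    then show False using that n by (simp add: frame_def cmod_def)
  qed
  have "continuous_on frame (\<lambda>u. 1 / (1 - exp (of_real (2 * pi) * u)))"
    using 2 by (intro continuous_intros) auto
  then have "bounded ((\<lambda>u. 1 / (1 - exp (of_real (2 * pi) * u))) ` frame)"
    using compact_frame by (intro compact_imp_bounded compact_continuous_image)
  then obtain B2 where B2: "B2 > 0" "\<forall>x\<in>(\<lambda>u. 1 / (1 - exp (of_real (2 * pi) * u))) ` frame. norm x \<le> B2"
    unfolding bounded_pos by blast
  show ?thesis
    using B1 B2 by (intro exI[of _ "max B1 B2"]) (auto simp: le_max_iff_disj)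
qed

lemma tendsto_mult_simple_pole:
  fixes E :: "complex \<Rightarrow> complex"
  assumes "(E has_field_derivative D) (at p)" "D \<noteq> 0" "E p = 0"
  shows "((\<lambda>z. (z - p) / E z) \<longlongrightarrow> 1 / D) (at p)"
proof -
  have "((\<lambda>z. (E z - E p) / (z - p)) \<longlongrightarrow> D) (at p)"
    using assms(1) by (simp add: has_field_derivative_iff)
  then have "((\<lambda>z. 1 / ((E z - E p) / (z - p))) \<longlongrightarrow> 1 / D) (at p)"
    by (intro tendsto_intros assms)
  then show ?thesis by (simp add: assms(3))
qed

text \<open>The residues at \<open>pl k\<close> are -g(p_k) / (2 pi) for the first summand, as exp(2
  pi p_k) = -1, and +g(p_k) / (2 pi) for the second.\<close>

lemma pole_cancels:
  assumes "isCont g (pl k)"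
  shows "((\<lambda>z. (z - pl k) * (g z / (1 + exp (of_real (2 * pi) * z)) + g (pl k) * ker \<theta> (z - pl k))) \<longlongrightarrow> 0) (at (pl k))"
proof -
  define p where "p = pl k"
  have "((\<lambda>z. 1 + exp (of_real (2 * pi) * z)) has_field_derivative of_real (2 * pi) * exp (of_real (2 * pi) * p)) (at p)"
    by (auto intro!: derivative_eq_intros)
  then have "((\<lambda>z. 1 + exp (of_real (2 * pi) * z)) has_field_derivative - of_real (2 * pi)) (at p)"
    unfolding p_def exp_2pi_pl by simp
  then have s: "((\<lambda>z. (z - p) / (1 + exp (of_real (2 * pi) * z))) \<longlongrightarrow> 1 / (- of_real (2 * pi))) (at p)"
    by (rule tendsto_mult_simple_pole) (unfold p_def exp_2pi_pl, auto)
  have "((\<lambda>z. exp (of_real (2 * pi) * \<i> * (z - p)) - 1) has_field_derivative of_real (2 * pi) * \<i>) (at p)"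
    by (auto intro!: derivative_eq_intros)
  then have k: "((\<lambda>z. (z - p) / (exp (of_real (2 * pi) * \<i> * (z - p)) - 1)) \<longlongrightarrow> 1 / (of_real (2 * pi) * \<i>)) (at p)"
    by (rule tendsto_mult_simple_pole) auto
  have e: "((\<lambda>z. \<i> * exp (of_real (2 * pi * \<theta>) * \<i> * (z - p))) \<longlongrightarrow> \<i> * exp (of_real (2 * pi * \<theta>) * \<i> * (p - p))) (at p)"
    by (intro tendsto_intros)
  have g: "(g \<longlongrightarrow> g p) (at p)" using assms by (simp add: isCont_def p_def)
  have "((\<lambda>z. g z * ((z - p) / (1 + exp (of_real (2 * pi) * z))) +
      g p * ((\<i> * exp (of_real (2 * pi * \<theta>) * \<i> * (z - p))) * ((z - p) / (exp (of_real (2 * pi) * \<i> * (z - p)) - 1))))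
      \<longlongrightarrow> g p * (1 / (- of_real (2 * pi))) +
       g p * ((\<i> * exp (of_real (2 * pi * \<theta>) * \<i> * (p - p))) * (1 / (of_real (2 * pi) * \<i>)))) (at p)"
    by (intro tendsto_add tendsto_mult s k e g tendsto_const)
  moreover have "g p * (1 / (- of_real (2 * pi))) +
       g p * ((\<i> * exp (of_real (2 * pi * \<theta>) * \<i> * (p - p))) * (1 / (of_real (2 * pi) * \<i>))) = 0"
    by (simp add: field_simps)
  moreover have "(\<lambda>z. g z * ((z - p) / (1 + exp (of_real (2 * pi) * z))) +
      g p * ((\<i> * exp (of_real (2 * pi * \<theta>) * \<i> * (z - p))) * ((z - p) / (exp (of_real (2 * pi) * \<i> * (z - p)) - 1))))
     = (\<lambda>z. (z - p) * (g z / (1 + exp (of_real (2 * pi) * z)) + g p * ker \<theta> (z - p)))"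
    unfolding ker_def by (simp add: fun_eq_iff distrib_left mult_ac)
  ultimately show ?thesis by (simp add: p_def)
qed

text \<open>Compares heights through the pole: a point w of the small disc satisfies
  \<open>hgt w \<le> 24 * hgt z\<close> for every z in the same window, so bounds on the circle
  about the pole transfer to points inside it.\<close>

lemma hgt_near_pl:
  shows "z \<in> window k \<Longrightarrow> hgt (pl k) \<le> 3 * hgt z"
    and "norm (w - pl k) \<le> 1/4 \<Longrightarrow> hgt w \<le> 8 * hgt (pl k)"
proof -
  define t where "t = real k + 1/2"
  have t: "t \<ge> 1/2" by (simp add: t_def)
  have hp: "hgt (pl k) = (1 + t * t) / t" by (simp add: hgt_def pl_def cmod_def t_def power2_eq_square)
  show "hgt (pl k) \<le> 3 * hgt z" if z: "z \<in> window k"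
  proof -
    have im: "Im z > 0" using z window_subset by auto
    have "(1 + t * t) / t = 1 / t + t" using t by (simp add: field_simps)
    also have "1 / t \<le> 2" using t by (simp add: field_simps)
    also have "t \<le> Im z + 3/4" using z unfolding t_def window_def mem_Collect_eq by linarith
    finally show ?thesis unfolding hp using hgt_bounds(1,2)[OF im] by linarith
  qed
  show "hgt w \<le> 8 * hgt (pl k)" if w: "norm (w - pl k) \<le> 1/4"
  proof -
    have "\<bar>Im (w - pl k)\<bar> \<le> 1/4" using abs_Im_le_cmod[of "w - pl k"] w by linarith
    then have "\<bar>Im w - t\<bar> \<le> 1/4" by (simp add: pl_def t_def)
    then have im: "Im w \<ge> t / 2" using t by linarith
    have "norm (pl k) = t" by (simp add: pl_def cmod_def t_def)
    then have "norm w \<le> 2 * t" using norm_triangle_ineq2[of w "pl k"] w t by linarith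
    then have "(norm w)\<^sup>2 \<le> (2 * t)\<^sup>2" by (intro power_mono) auto
    then have nw: "1 + (norm w)\<^sup>2 \<le> 4 * (1 + t * t)" by (simp add: power2_eq_square)
    have "hgt w \<le> (4 * (1 + t * t)) / (t / 2)"
      unfolding hgt_def using nw im t by (intro frac_le) auto
    also have "\<dots> = 8 * hgt (pl k)" unfolding hp by (simp add: field_simps)
    finally show ?thesis .
  qed
qed

text \<open>The cancelled pole is a removable singularity. Outside the disc of radius 1/4 both
  summands are bounded through \<open>frame\<close>; inside, the maximum principle carries over the
  bound from the circle.\<close>

lemma pole_part_moderate:
  fixes \<theta> :: real
  assumes g: "moderate_on \<H> g"
  defines "X \<equiv> \<lambda>k z. g z / (1 + exp (of_real (2 * pi) * z)) + g (pl k) * ker \<theta> (z - pl k)"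
  shows "\<exists>C N. \<forall>k. \<exists>h. h holomorphic_on window k \<and> (\<forall>z\<in>window k - {pl k}. h z = X k z) \<and>
     (\<forall>z\<in>window k. norm (h z) \<le> C * hgt z ^ N)"
proof -
  obtain K N where gh: "g holomorphic_on \<H>" "K > 0" and K: "\<And>z M. z \<in> \<H> \<Longrightarrow> N \<le> M \<Longrightarrow> norm (g z) \<le> K * hgt z ^ M"
    using moderate_onE[OF g order_refl] by metis
  obtain B where B: "B > 0" "\<forall>u\<in>frame. norm (ker \<theta> u) \<le> B \<and> norm (1 / (1 - exp (of_real (2 * pi) * u))) \<le> B"
    using frame_bounds by blast
  have pH: "pl k \<in> \<H>" for k by (simp add: pl_def)
  have ploc: "pl k \<in> window k" for k by (simp add: pl_def window_def strip_def)
  have cb: "cball (pl k) (1/4) \<subseteq> window k" for k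
  proof
    fix z assume "z \<in> cball (pl k) (1/4)"
    then have "norm (z - pl k) \<le> 1/4" by (simp add: dist_norm norm_minus_commute)
    then have "\<bar>Re (z - pl k)\<bar> \<le> 1/4" "\<bar>Im (z - pl k)\<bar> \<le> 1/4"
      using abs_Re_le_cmod[of "z - pl k"] abs_Im_le_cmod[of "z - pl k"] by linarith+
    then have "\<bar>Re z\<bar> \<le> 1/4" "\<bar>Im z - (real k + 1/2)\<bar> \<le> 1/4" by (simp_all add: pl_def)
    then show "z \<in> window k" unfolding window_def strip_def mem_Collect_eq by linarith
  qed
  have far: "norm (X k z) \<le> B * (norm (g z) + norm (g (pl k)))" if z: "z \<in> window k" "norm (z - pl k) \<ge> 1/4" for k z
  proof -
    have u: "z - pl k \<in> frame" using z by (auto simp: frame_def window_def strip_def pl_def)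
    \<comment> \<open>Recentring at the pole flips the sign of the exponential, whence the minus
      sign in \<open>frame_bounds\<close>.\<close>
    have "exp (of_real (2 * pi) * (z - pl k)) = - exp (of_real (2 * pi) * z)"
      unfolding right_diff_distrib exp_diff exp_2pi_pl by simp
    then have "norm (1 / (1 + exp (of_real (2 * pi) * z))) \<le> B" using B u by fastforce
    then have "norm (g z) * norm (1 / (1 + exp (of_real (2 * pi) * z))) \<le> norm (g z) * B"
      by (rule mult_left_mono) simp
    then have "norm (g z / (1 + exp (of_real (2 * pi) * z))) \<le> norm (g z) * B"
      by (simp add: norm_divide)
    moreover have "norm (g (pl k) * ker \<theta> (z - pl k)) \<le> norm (g (pl k)) * B"
      unfolding norm_mult using B u by (intro mult_left_mono) auto
    ultimately show ?thesis unfolding X_def using norm_triangle_ineq by (smt (verit) distrib_left mult.commute)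
  qed
  have "\<exists>h. h holomorphic_on window k \<and> (\<forall>z\<in>window k - {pl k}. h z = X k z) \<and>
     (\<forall>z\<in>window k. norm (h z) \<le> (2 * B * K * 24 ^ N) * hgt z ^ N)" for k
  proof -
    have ne1: "1 + exp (of_real (2 * pi) * z) \<noteq> 0" if z: "z \<in> window k - {pl k}" for z
    proof
      assume "1 + exp (of_real (2 * pi) * z) = 0"
      then obtain n :: int where n: "Re z = 0" "Im z = of_int n + 1/2"
        unfolding one_plus_exp_eq_0_iff by blast
      then have "\<bar>of_int n - real k\<bar> < 1" using z by (auto simp: window_def)
      then have "\<bar>n - int k\<bar> < 1" by linarith
      then have "z = pl k" using n by (simp add: complex_eq_iff pl_def)
      then show False using z by simp
    qed
    have ne2: "z - pl k \<noteq> of_int n" if z: "z \<in> window k - {pl k}" for z n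
    proof
      assume e: "z - pl k = of_int n"
      then have "Re (z - pl k) = of_int n" by simp
      then have "\<bar>real_of_int n\<bar> < 1" using z by (simp add: pl_def window_def strip_def)
      then have "n = 0" by linarith
      then show False using e z by simp
    qed
    have "X k holomorphic_on window k - {pl k}"
      unfolding X_def
      by (intro holomorphic_intros ker_holomorphic ne2 holomorphic_on_subset[OF gh(1)])
         (use ne1 window_subset in auto)
    moreover have "((\<lambda>z. (z - pl k) * X k z) \<longlongrightarrow> 0) (at (pl k))"
      unfolding X_def
    proof (rule pole_cancels)
      show "isCont g (pl k)"
        using holomorphic_on_imp_continuous_on[OF gh(1)] open_upper_half_plane pH
        by (simp add: continuous_on_eq_continuous_at)
    qed
    moreover have "pl k \<in> interior (window k)" using open_window ploc by (simp add: interior_open)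
    ultimately obtain h where h: "h holomorphic_on window k" "\<And>z. z \<in> window k - {pl k} \<Longrightarrow> h z = X k z"
      using holomorphic_on_extend_lim by blast
    have "norm (h z) \<le> (2 * B * K * 24 ^ N) * hgt z ^ N" if z: "z \<in> window k" for z
    proof -
      have im: "Im z > 0" using z window_subset by auto
      have hz: "hgt z \<ge> 2" by (rule hgt_bounds(1)[OF im])
      have hp2: "hgt (pl k) \<ge> 2" using hgt_bounds(1)[of "pl k"] pH by auto
      have gb: "norm (g w) \<le> K * (24 * hgt z) ^ N" if "w \<in> \<H>" "hgt w \<le> 24 * hgt z" for w
      proof -
        have "norm (g w) \<le> K * hgt w ^ N" using K[OF that(1), of N] by simp
        also have "\<dots> \<le> K * (24 * hgt z) ^ N"
          using gh that hgt_bounds(1)[of w] by (intro mult_left_mono power_mono) auto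
        finally show ?thesis .
      qed
      have gp: "norm (g (pl k)) \<le> K * (24 * hgt z) ^ N"
        using hgt_near_pl(1)[OF z] hz by (intro gb pH) linarith
      have XX: "norm (X k w) \<le> (2 * B * K * 24 ^ N) * hgt z ^ N"
        if "w \<in> window k" "norm (w - pl k) \<ge> 1/4" "hgt w \<le> 24 * hgt z" for w
      proof -
        have "norm (X k w) \<le> B * (K * (24 * hgt z) ^ N + K * (24 * hgt z) ^ N)"
          using far[OF that(1,2)] gb[of w] gp that window_subset B
          by (smt (verit) mult_left_mono subsetD)
        then show ?thesis by (simp add: power_mult_distrib mult_ac)
      qed
      show ?thesis
      proof (cases "norm (z - pl k) \<ge> 1/4")
        case True
        then have "z \<noteq> pl k" by auto
        then show ?thesis using h(2)[of z] z XX[OF z True] hz by simp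
      next
        case False
        show ?thesis
        \<comment> \<open>On the circle h equals \<open>X k\<close>, bounded by the height of w
          there; the factor 24 = 3 * 8 converts this to the height of the given z.\<close>
        proof (rule maximum_modulus_frontier[of h "cball (pl k) (1/4)"])
          show "h holomorphic_on interior (cball (pl k) (1/4))"
            using h(1) cb interior_subset by (blast intro: holomorphic_on_subset)
          show "continuous_on (closure (cball (pl k) (1/4))) h"
            using holomorphic_on_imp_continuous_on[OF h(1)] cb by (simp add: continuous_on_subset)
          show "z \<in> cball (pl k) (1/4)" using False by (simp add: dist_norm norm_minus_commute)
          fix w assume "w \<in> frontier (cball (pl k) (1/4))"
          then have w: "norm (w - pl k) = 1/4" by (simp add: dist_norm norm_minus_commute)
          then have wl: "w \<in> window k" using cb[of k] by (auto simp: dist_norm norm_minus_commute)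
          have "hgt w \<le> 24 * hgt z" using hgt_near_pl(1)[OF z] hgt_near_pl(2)[of w k] w by linarith
          moreover have "w \<noteq> pl k" using w by auto
          ultimately show "norm (h w) \<le> (2 * B * K * 24 ^ N) * hgt z ^ N"
            using XX[OF wl] h(2)[of w] wl w by simp
        qed simp
      qed
    qed
    then show ?thesis using h by blast
  qed
  then show ?thesis by blast
qed

lemma strip_window: "z \<in> strip \<Longrightarrow> z \<in> window (nat \<lfloor>Im z\<rfloor>)"
proof -
  assume z: "z \<in> strip"
  then have "Im z > 0" by (simp add: strip_def)
  then have "real (nat \<lfloor>Im z\<rfloor>) = of_int \<lfloor>Im z\<rfloor>" by simp
  moreover have "of_int \<lfloor>Im z\<rfloor> \<le> Im z" "Im z < of_int \<lfloor>Im z\<rfloor> + 1" by linarith+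
  ultimately have "\<bar>Im z - (real (nat \<lfloor>Im z\<rfloor>) + 1/2)\<bar> < 3/4" by linarith
  then show ?thesis using z by (simp add: window_def)
qed

text \<open>In window k the pole part of \<open>pl k\<close> plus the series without its k-th term
  is a holomorphic version of the full expression; these local versions are glued. The explicit
  formula is claimed only off the imaginary axis, where no pole lies.\<close>

lemma corrected_kernel_sum:
  assumes g: "moderate_on \<H> g" and \<theta>: "0 \<le> \<theta>" "\<theta> < 1"
  shows "\<exists>c. moderate_on strip c \<and> (\<forall>z\<in>strip. Re z \<noteq> 0 \<longrightarrow> summable (\<lambda>n. g (pl n) * ker \<theta> (z - pl n)) \<and>
     c z = g z / (1 + exp (of_real (2 * pi) * z)) + (\<Sum>n. g (pl n) * ker \<theta> (z - pl n)))"
proof -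
  define T where "T k n z = (if n = k then 0 else g (pl n) * ker \<theta> (z - pl n))" for k n z
  define X where "X k z = g z / (1 + exp (of_real (2 * pi) * z)) + g (pl k) * ker \<theta> (z - pl k)" for k z
  define F where "F z = g z / (1 + exp (of_real (2 * pi) * z)) + (\<Sum>n. g (pl n) * ker \<theta> (z - pl n))" for z
  obtain C1 N1 where T0: "\<forall>k. (\<lambda>z. \<Sum>n. T k n z) holomorphic_on window k \<and>
      (\<forall>z\<in>window k. summable (\<lambda>n. T k n z) \<and> norm (\<Sum>n. T k n z) \<le> C1 * hgt z ^ N1)"
    using kernel_sum_moderate[OF g \<theta>, folded T_def] by blast
  then have T: "\<And>k. (\<lambda>z. \<Sum>n. T k n z) holomorphic_on window k"
    "\<And>k z. z \<in> window k \<Longrightarrow> summable (\<lambda>n. T k n z)"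
    "\<And>k z. z \<in> window k \<Longrightarrow> norm (\<Sum>n. T k n z) \<le> C1 * hgt z ^ N1"
    by blast+
  obtain C2 N2 where "\<forall>k. \<exists>h. h holomorphic_on window k \<and> (\<forall>z\<in>window k - {pl k}. h z = X k z) \<and>
     (\<forall>z\<in>window k. norm (h z) \<le> C2 * hgt z ^ N2)"
    using pole_part_moderate[OF g, of \<theta>] unfolding X_def by blast
  then obtain h where h: "\<And>k. h k holomorphic_on window k"
    "\<And>k z. z \<in> window k - {pl k} \<Longrightarrow> h k z = X k z"
    "\<And>k z. z \<in> window k \<Longrightarrow> norm (h k z) \<le> C2 * hgt z ^ N2"
    by metis
  define H where "H k z = h k z + (\<Sum>n. T k n z)" for k z
  have F: "summable (\<lambda>n. g (pl n) * ker \<theta> (z - pl n)) \<and> H k z = F z" if z: "z \<in> window k" "z \<noteq> pl k" for k z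
  proof -
    have "(\<lambda>n. T k n z) sums (\<Sum>n. T k n z)" using T(2)[OF z(1)] by (rule summable_sums)
    moreover have "(\<lambda>n. if n = k then g (pl n) * ker \<theta> (z - pl n) else 0) sums (g (pl k) * ker \<theta> (z - pl k))"
      by (rule sums_single)
    ultimately have "(\<lambda>n. T k n z + (if n = k then g (pl n) * ker \<theta> (z - pl n) else 0)) sums
        ((\<Sum>n. T k n z) + g (pl k) * ker \<theta> (z - pl k))"
      by (rule sums_add)
    moreover have "(\<lambda>n. T k n z + (if n = k then g (pl n) * ker \<theta> (z - pl n) else 0)) =
        (\<lambda>n. g (pl n) * ker \<theta> (z - pl n))"
      by (auto simp: T_def)
    ultimately have s: "(\<lambda>n. g (pl n) * ker \<theta> (z - pl n)) sums ((\<Sum>n. T k n z) + g (pl k) * ker \<theta> (z - pl k))"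
      by simp
    then show ?thesis using h(2)[of z k] z sums_unique[OF s] sums_summable[OF s] by (simp add: H_def X_def F_def add.commute)
  qed
  have neq: "z \<noteq> pl j" if "z \<in> window k" "j \<noteq> k" for z j k
    using window_Im_pl[OF that] by auto
  \<comment> \<open>A point of two different windows is the pole of neither, so both local versions
    equal \<open>F z\<close> there.\<close>
  have eq: "H k z = H j z" if "z \<in> window k" "z \<in> window j" for z k j
    using F[OF that(1)] F[OF that(2)] neq[OF that(1), of j] neq[OF that(2), of k] by (cases "j = k") auto
  define c where "c z = H (nat \<lfloor>Im z\<rfloor>) z" for z
  have c: "c z = H k z" if "z \<in> window k" for z k
    unfolding c_def using that by (intro eq strip_window) (auto simp: window_def)
  have "c holomorphic_on strip"
    unfolding holomorphic_on_open[OF open_strip]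
  proof
    fix z assume "z \<in> strip"
    then have z: "z \<in> window (nat \<lfloor>Im z\<rfloor>)" by (rule strip_window)
    have "H (nat \<lfloor>Im z\<rfloor>) holomorphic_on window (nat \<lfloor>Im z\<rfloor>)"
      unfolding H_def by (intro holomorphic_intros h T)
    then have "c holomorphic_on window (nat \<lfloor>Im z\<rfloor>)" using c by (metis holomorphic_transform)
    then show "\<exists>f'. (c has_field_derivative f') (at z)"
      using z open_window by (simp add: holomorphic_on_open)
  qed
  moreover have "norm (c z) \<le> (\<bar>C1\<bar> + \<bar>C2\<bar>) * hgt z ^ max N1 N2" if z: "z \<in> strip" for z
  proof -
    define k where "k = nat \<lfloor>Im z\<rfloor>"
    have zk: "z \<in> window k" unfolding k_def using z by (rule strip_window)
    have h2: "hgt z \<ge> 2" using z hgt_bounds(1) by (auto simp: strip_def)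
    have "norm (c z) \<le> C2 * hgt z ^ N2 + C1 * hgt z ^ N1"
      unfolding c[OF zk] H_def using h(3)[OF zk] T(3)[OF zk] by (intro norm_triangle_le add_mono)
    also have "\<dots> \<le> \<bar>C2\<bar> * hgt z ^ max N1 N2 + \<bar>C1\<bar> * hgt z ^ max N1 N2"
      by (intro add_mono mult_mono power_increasing) (use h2 in auto)
    finally show ?thesis by (simp add: distrib_right add.commute)
  qed
  ultimately have "moderate_on strip c" by (rule moderate_onI)
  moreover have "summable (\<lambda>n. g (pl n) * ker \<theta> (z - pl n)) \<and> c z = F z" if "z \<in> strip" "Re z \<noteq> 0" for z
  proof -
    have "z \<noteq> pl (nat \<lfloor>Im z\<rfloor>)" using that by (auto simp: pl_def complex_eq_iff)
    then show ?thesis unfolding c_def by (rule F[OF strip_window[OF that(1)]])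
  qed
  ultimately show ?thesis unfolding F_def by blast
qed

text \<open>Shifting reindexes both translate series, and each equation is off by one boundary term:
  the term without translation in the forward series, which lives in c, and the first term of the
  backward series. Together these contribute g(z) / s(z) + g(z) (s(z) - 1) / s(z) = g(z). The kernel
  series solves the homogeneous equation and adds nothing.\<close>

lemma difference_equation_strip:
  assumes g: "moderate_on \<H> g" and \<theta>: "0 \<le> \<theta>" "\<theta> < 1"
  defines "\<mu> \<equiv> exp (- (of_real (2 * pi * \<theta>) * \<i>))"
  shows "\<exists>f. moderate_on strip f \<and> (\<forall>z. z \<in> strip \<longrightarrow> z + 1 \<in> strip \<longrightarrow> \<mu> * f (z + 1) - f z = g z)"
proof -
  have l1: "norm \<mu> = 1" by (simp add: \<mu>_def)
  then have l0: "\<mu> \<noteq> 0" by auto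
  define P where "P n z = \<mu> ^ Suc n * g (z + of_real (1 * real (Suc n))) / (1 + exp (of_real (2 * pi) * (of_real 1 * z + of_nat (Suc n))))" for n z
  define M where "M n z = inverse \<mu> ^ Suc n * g (z + of_real (- 1 * real (Suc n))) / (1 + exp (of_real (2 * pi) * (of_real (- 1) * z + of_nat (Suc n))))" for n z
  \<comment> \<open>This is the reciprocal of the cut-off function s of the overview.\<close>
  define s where "s z = 1 + exp (of_real (2 * pi) * z)" for z :: complex
  have n1: "norm (\<mu> ^ Suc n) = 1" "norm (inverse \<mu> ^ Suc n) = 1" for n
    by (simp_all add: norm_mult norm_power norm_inverse l1)
  have P: "moderate_on strip (\<lambda>z. \<Sum>n. P n z)" "\<And>z. z \<in> strip \<Longrightarrow> summable (\<lambda>n. P n z)"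
    unfolding P_def
    by (rule translate_sum_moderate(1)[OF g _ n1(1)], simp,
        rule translate_sum_moderate(2)[OF g _ n1(1)], simp, assumption)
  have M: "moderate_on strip (\<lambda>z. \<Sum>n. M n z)" "\<And>z. z \<in> strip \<Longrightarrow> summable (\<lambda>n. M n z)"
    unfolding M_def
    by (rule translate_sum_moderate(1)[OF g _ n1(2)], simp,
        rule translate_sum_moderate(2)[OF g _ n1(2)], simp, assumption)
  obtain c where c1: "moderate_on strip c" and c23: "\<forall>z\<in>strip. Re z \<noteq> 0 \<longrightarrow> summable (\<lambda>n. g (pl n) * ker \<theta> (z - pl n)) \<and>
     c z = g z / s z + (\<Sum>n. g (pl n) * ker \<theta> (z - pl n))"
    using corrected_kernel_sum[OF g \<theta>, folded s_def] by blast
  note c = c1 c23[rule_format, THEN conjunct1] c23[rule_format, THEN conjunct2]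
  define f where "f z = (\<Sum>n. M n z) - (\<Sum>n. P n z) - c z" for z
  have "moderate_on strip f"
    unfolding f_def by (intro moderate_on_diff P M c strip_subset)
  moreover have "\<mu> * f (z + 1) - f z = g z" if z: "z \<in> strip" "z + 1 \<in> strip" for z
  proof -
    \<comment> \<open>Both points in the strip force -3/4 < Re z < -1/4, so neither meets the
      imaginary axis and the formula for c applies to both.\<close>
    have re: "Re z \<noteq> 0" "Re (z + 1) \<noteq> 0" using z by (auto simp: strip_def abs_if split: if_splits)
    have "s z \<noteq> 0" using re unfolding s_def one_plus_exp_eq_0_iff by simp
    have "(\<lambda>n. \<mu> * P n (z + 1)) = (\<lambda>n. P (Suc n) z)"
      unfolding P_def by (simp add: fun_eq_iff algebra_simps)
    then have "\<mu> * (\<Sum>n. P n (z + 1)) = (\<Sum>n. P (Suc n) z)"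
      using suminf_mult[OF P(2)[OF z(2)], of \<mu>] by simp
    also have "\<dots> = (\<Sum>n. P n z) - P 0 z" by (rule suminf_split_head[OF P(2)[OF z(1)]])
    also have "P 0 z = \<mu> * (g (z + 1) / s (z + 1))" by (simp add: P_def s_def algebra_simps)
    finally have PP: "\<mu> * (\<Sum>n. P n (z + 1)) = (\<Sum>n. P n z) - \<mu> * (g (z + 1) / s (z + 1))" .
    define Y where "Y = g z * (s z - 1) / s z"
    have "(\<lambda>n. M n z) = (\<lambda>n. \<mu> * M (Suc n) (z + 1))"
      unfolding M_def using l0 by (simp add: fun_eq_iff algebra_simps)
    then have "(\<Sum>n. M n z) = \<mu> * (\<Sum>n. M (Suc n) (z + 1))"
      using suminf_mult[of "\<lambda>n. M (Suc n) (z + 1)" \<mu>] M(2)[OF z(2)]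
        summable_Suc_iff[of "\<lambda>n. M n (z + 1)"] by simp
    also have "(\<Sum>n. M (Suc n) (z + 1)) = (\<Sum>n. M n (z + 1)) - M 0 (z + 1)"
      by (rule suminf_split_head[OF M(2)[OF z(2)]])
    also have "M 0 (z + 1) = inverse \<mu> * g z / (1 + inverse (s z - 1))"
      by (simp add: M_def s_def exp_minus)
    also have "1 + inverse (s z - 1) = s z / (s z - 1)"
      by (simp add: s_def field_simps)
    also have "inverse \<mu> * g z / (s z / (s z - 1)) = inverse \<mu> * Y" by (simp add: Y_def)
    also have "\<mu> * ((\<Sum>n. M n (z + 1)) - inverse \<mu> * Y) = \<mu> * (\<Sum>n. M n (z + 1)) - (\<mu> * inverse \<mu>) * Y"
      by (simp only: right_diff_distrib mult.assoc)
    also have "\<mu> * inverse \<mu> = 1" using l0 by simp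
    finally have MM: "\<mu> * (\<Sum>n. M n (z + 1)) = (\<Sum>n. M n z) + Y" by simp
    have k: "\<mu> * ker \<theta> (z + 1 - pl n) = ker \<theta> (z - pl n)" for n
      using ker_add_1[of \<theta> "z - pl n"] by (simp add: \<mu>_def algebra_simps)
    have "(\<lambda>n. \<mu> * (g (pl n) * ker \<theta> (z + 1 - pl n))) = (\<lambda>n. g (pl n) * ker \<theta> (z - pl n))"
      unfolding k[symmetric] by (simp only: mult.left_commute)
    then have "\<mu> * (\<Sum>n. g (pl n) * ker \<theta> (z + 1 - pl n)) = (\<Sum>n. g (pl n) * ker \<theta> (z - pl n))"
      using suminf_mult[OF c(2)[OF z(2) re(2)], of \<mu>] by simp
    then have CC: "\<mu> * c (z + 1) = c z - g z / s z + \<mu> * (g (z + 1) / s (z + 1))"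
      unfolding c(3)[OF z(1) re(1)] c(3)[OF z(2) re(2)] by (simp add: distrib_left)
    have "Y + g z / s z = g z" using \<open>s z \<noteq> 0\<close> by (simp add: Y_def field_simps)
    then show ?thesis unfolding f_def right_diff_distrib PP MM CC by (simp add: algebra_simps)
  qed
  ultimately show ?thesis by blast
qed

subsection \<open>The scalar difference equation on the half plane\<close>

text \<open>If \<open>\<mu> * f (z + 1) - f z = g z\<close> throughout, then \<open>\<mu> powi n * f
  (z + of_int n) = f z + orbit_sum \<mu> g n z\<close> for every integer n; the second branch is the
  same relation solved backwards.\<close>

definition orbit_sum :: "complex \<Rightarrow> (complex \<Rightarrow> complex) \<Rightarrow> int \<Rightarrow> complex \<Rightarrow> complex" where
  "orbit_sum \<mu> g n z = (if n \<ge> 0 then \<Sum>j<nat n. \<mu> ^ j * g (z + of_nat j)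
     else - (\<Sum>j<nat (- n). inverse \<mu> ^ Suc j * g (z - of_nat (Suc j))))"

lemma orbit_sum_step:
  assumes "\<mu> \<noteq> 0"
  shows "orbit_sum \<mu> g (n + 1) z = orbit_sum \<mu> g n z + \<mu> powi n * g (z + of_int n)"
proof (cases "n \<ge> 0")
  case True
  then obtain m where "n = int m" using nonneg_int_cases by blast
  then show ?thesis by (simp add: orbit_sum_def nat_add_distrib)
next
  case False
  define m where "m = nat (- n - 1)"
  have n: "n = - int (Suc m)" using False by (simp add: m_def)
  have 1: "orbit_sum \<mu> g (n + 1) z = - (\<Sum>j<m. inverse \<mu> ^ Suc j * g (z - of_nat (Suc j)))"
    by (auto simp: orbit_sum_def n)
  have 2: "orbit_sum \<mu> g n z = - (\<Sum>j<Suc m. inverse \<mu> ^ Suc j * g (z - of_nat (Suc j)))"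
    using False by (simp only: orbit_sum_def if_False n minus_minus nat_int)
  have 3: "\<mu> powi n = inverse \<mu> ^ Suc m" unfolding n by (simp only: power_int_minus power_int_of_nat power_inverse)
  have 4: "z + of_int n = z - of_nat (Suc m)" unfolding n by simp
  show ?thesis unfolding 1 2 3 4 by simp
qed

text \<open>Splits off the first step where \<open>orbit_sum_step\<close> splits off the last. This
  form compares continuations from neighbouring base points.\<close>

lemma orbit_sum_shift:
  assumes "\<mu> \<noteq> 0"
  shows "orbit_sum \<mu> g (n + 1) z = g z + \<mu> * orbit_sum \<mu> g n (z + 1)"
proof (induction n rule: int_induct[where k = 0])
  case base
  show ?case by (simp add: orbit_sum_def)
next
  case (step1 i)
  have "orbit_sum \<mu> g (i + 1 + 1) z = orbit_sum \<mu> g (i + 1) z + \<mu> powi (i + 1) * g (z + of_int (i + 1))"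
    by (rule orbit_sum_step[OF assms])
  also have "\<dots> = g z + \<mu> * (orbit_sum \<mu> g i (z + 1) + \<mu> powi i * g (z + 1 + of_int i))"
    unfolding step1.IH using assms by (simp add: power_int_add algebra_simps)
  finally show ?case unfolding orbit_sum_step[OF assms, of g i "z + 1"] .
next
  case (step2 i)
  have 1: "orbit_sum \<mu> g (i + 1) z = orbit_sum \<mu> g i z + \<mu> powi i * g (z + of_int i)"
    by (rule orbit_sum_step[OF assms])
  have 2: "orbit_sum \<mu> g i (z + 1) = orbit_sum \<mu> g (i - 1) (z + 1) + \<mu> powi (i - 1) * g (z + of_int i)"
    using orbit_sum_step[OF assms, of g "i - 1" "z + 1"] by (simp add: add.commute)
  have 3: "\<mu> powi i = \<mu> * \<mu> powi (i - 1)" using assms by (simp add: power_int_diff)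
  have "orbit_sum \<mu> g i z = g z + \<mu> * orbit_sum \<mu> g (i - 1) (z + 1)"
    using step2.IH unfolding 1 2 3 by (simp add: distrib_left mult.assoc)
  then show ?case by simp
qed

lemma orbit_sum_holomorphic:
  assumes "g holomorphic_on \<H>"
  shows "orbit_sum \<mu> g n holomorphic_on \<H>"
proof -
  have tr: "(\<lambda>z. g (z + of_real c)) holomorphic_on \<H>" for c
  proof -
    have "g \<circ> (\<lambda>z. z + of_real c) holomorphic_on \<H>"
      by (rule holomorphic_on_compose_gen[OF _ assms]) (auto intro!: holomorphic_intros)
    then show ?thesis by (simp add: o_def)
  qed
  have "(\<lambda>z. g (z + of_nat j)) holomorphic_on \<H>" for j using tr[of "real j"] by simp
  moreover have "(\<lambda>z. g (z - of_nat j)) holomorphic_on \<H>" for j using tr[of "- real j"] by simp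
  ultimately show ?thesis
    unfolding orbit_sum_def by (cases "n \<ge> 0") (auto intro!: holomorphic_intros simp del: of_nat_Suc)
qed

lemma norm_orbit_sum_le:
  assumes "norm \<mu> = 1" and B: "\<And>j::int. \<bar>j\<bar> \<le> \<bar>n\<bar> \<Longrightarrow> norm (g (z + of_int j)) \<le> B"
  shows "norm (orbit_sum \<mu> g n z) \<le> of_int \<bar>n\<bar> * B"
proof (cases "n \<ge> 0")
  case True
  have "norm (orbit_sum \<mu> g n z) \<le> (\<Sum>j<nat n. B)"
    unfolding orbit_sum_def using True
    by (simp only: if_True) (intro sum_norm_le, use B[of "int j" for j] in \<open>auto simp: norm_mult norm_power assms(1)\<close>)
  then show ?thesis using True by simp
next
  case False
  have B': "norm (g (z - of_nat (Suc j))) \<le> B" if "j < nat (- n)" for j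
  proof -
    have "z + of_int (- int (Suc j)) = z - of_nat (Suc j)" by simp
    moreover have "norm (g (z + of_int (- int (Suc j)))) \<le> B" using that by (intro B) auto
    ultimately show ?thesis by (simp only:)
  qed
  have "norm (orbit_sum \<mu> g n z) \<le> (\<Sum>j<nat (-n). B)"
    unfolding orbit_sum_def using False
    by (simp only: if_False norm_minus_cancel)
       (intro sum_norm_le, use B' in \<open>auto simp: norm_mult norm_power norm_inverse assms(1)\<close>)
  then show ?thesis using False by simp
qed

text \<open>The equation dictates the value at z from the value at a translate of z in the strip. On
  overlaps the choice of translate does not matter, because f solves the equation in the strip.
  Growth stays moderate since the number of steps and every height met on the way are polynomial in
  \<open>hgt z\<close>.\<close>

lemma difference_equation_extend:
  assumes g: "moderate_on \<H> g" and f: "moderate_on strip f" and \<mu>: "norm \<mu> = 1"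
    and eq: "\<And>z. z \<in> strip \<Longrightarrow> z + 1 \<in> strip \<Longrightarrow> \<mu> * f (z + 1) - f z = g z"
  shows "\<exists>F. moderate_on \<H> F \<and> (\<forall>z\<in>\<H>. \<mu> * F (z + 1) - F z = g z)"
proof -
  have \<mu>0: "\<mu> \<noteq> 0" using \<mu> by auto
  obtain K1 N1 where gh: "g holomorphic_on \<H>" "K1 > 0" and K1: "\<And>z M. z \<in> \<H> \<Longrightarrow> N1 \<le> M \<Longrightarrow> norm (g z) \<le> K1 * hgt z ^ M"
    using moderate_onE[OF g order_refl] by metis
  obtain K2 N2 where fh: "f holomorphic_on strip" "K2 > 0" and K2: "\<And>z M. z \<in> strip \<Longrightarrow> N2 \<le> M \<Longrightarrow> norm (f z) \<le> K2 * hgt z ^ M"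
    using moderate_onE[OF f strip_subset] by metis
  define \<Phi> where "\<Phi> n z = \<mu> powi (- n) * (f (z - of_int n) + orbit_sum \<mu> g n (z - of_int n))" for n z
  define F where "F z = \<Phi> \<lfloor>Re z + 1/2\<rfloor> z" for z
  have step: "\<Phi> (n + 1) z = \<Phi> n z" if "z - of_int n \<in> strip" "z - of_int (n + 1) \<in> strip" for n z
  proof -
    define w where "w = z - of_int (n + 1)"
    have w: "w \<in> strip" "w + 1 \<in> strip" "z - of_int n = w + 1" using that by (auto simp: w_def)
    have "\<Phi> (n + 1) z = \<mu> powi (- (n + 1)) * (f w + (g w + \<mu> * orbit_sum \<mu> g n (w + 1)))"
      unfolding \<Phi>_def w_def[symmetric] orbit_sum_shift[OF \<mu>0] ..
    also have "f w + (g w + \<mu> * orbit_sum \<mu> g n (w + 1)) = \<mu> * (f (w + 1) + orbit_sum \<mu> g n (w + 1))"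
      using eq[OF w(1,2)] by (simp add: algebra_simps)
    also have "\<mu> powi (- (n + 1)) * (\<mu> * (f (w + 1) + orbit_sum \<mu> g n (w + 1))) =
        (\<mu> powi (- (n + 1)) * \<mu>) * (f (w + 1) + orbit_sum \<mu> g n (w + 1))" by simp
    also have "\<mu> powi (- (n + 1)) * \<mu> = \<mu> powi (- n)"
      using power_int_add_1[of \<mu> "- (n + 1)"] \<mu>0 by simp
    finally show ?thesis unfolding \<Phi>_def w(3) .
  qed
  have fl: "\<bar>Re z - of_int \<lfloor>Re z + 1/2\<rfloor>\<bar> \<le> 1/2" for z
    using floor_correct[of "Re z + 1/2"] by linarith
  have F: "F z = \<Phi> m z" if z: "z \<in> \<H>" "\<bar>Re z - of_int m\<bar> < 3/4" for z m
  proof -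
    define n where "n = \<lfloor>Re z + 1/2\<rfloor>"
    have n: "\<bar>Re z - of_int n\<bar> \<le> 1/2" unfolding n_def by (rule fl)
    have mem: "z - of_int n \<in> strip" "z - of_int m \<in> strip" using z n by (auto simp: strip_def)
    \<comment> \<open>Two admissible shifts of the same point differ by at most one, so a single use
      of \<open>step\<close> compares them.\<close>
    have "\<bar>of_int m - real_of_int n\<bar> < 2" using n z(2) by linarith
    then consider "m = n" | "m = n + 1" | "n = m + 1" by linarith
    then have "\<Phi> m z = \<Phi> n z" by cases (use step[of z n] step[of z m] mem in auto)
    then show ?thesis by (simp add: F_def n_def)
  qed
  have "F holomorphic_on \<H>"
    unfolding holomorphic_on_open[OF open_upper_half_plane]
  proof
    fix z assume z: "z \<in> \<H>"
    define n where "n = \<lfloor>Re z + 1/2\<rfloor>"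
    define U where "U = {w. w - of_int n \<in> strip}"
    have "open U" unfolding U_def 
      by (rule open_vimage[OF open_strip, of "\<lambda>w. w - of_int n", unfolded vimage_def]) (intro continuous_intros)
    have zU: "z \<in> U" using z fl[of z] by (auto simp: U_def strip_def n_def)
    have "f \<circ> (\<lambda>w. w - of_int n) holomorphic_on U"
      by (rule holomorphic_on_compose_gen[OF _ fh(1)]) (auto simp: U_def intro!: holomorphic_intros)
    moreover have "orbit_sum \<mu> g n \<circ> (\<lambda>w. w - of_int n) holomorphic_on U"
      by (rule holomorphic_on_compose_gen[OF _ orbit_sum_holomorphic[OF gh(1)]]) (auto simp: U_def strip_def intro!: holomorphic_intros)
    ultimately have "\<Phi> n holomorphic_on U" unfolding \<Phi>_def o_def by (intro holomorphic_intros)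
    then have "F holomorphic_on U"
      by (rule holomorphic_transform) (use F[of _ n] in \<open>auto simp: U_def strip_def\<close>)
    then show "\<exists>F'. (F has_field_derivative F') (at z)"
      using \<open>open U\<close> zU by (simp add: holomorphic_on_open)
  qed
  moreover have "norm (F z) \<le> (K2 * 2 ^ N2 + 2 * K1 * 16 ^ N1) * hgt z ^ max N2 (3 * N1 + 1)" if z: "z \<in> \<H>" for z
  proof -
    define n where "n = \<lfloor>Re z + 1/2\<rfloor>"
    define w where "w = z - of_int n"
    define H where "H = hgt z"
    have im: "Im z > 0" "Im w > 0" using z by (auto simp: w_def)
    have H2: "H \<ge> 2" using hgt_bounds(1)[OF im(1)] by (simp add: H_def)
    have rw: "\<bar>Re w\<bar> \<le> 1/2" using fl[of z] by (simp add: w_def n_def)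
    have ws: "w \<in> strip" using rw im by (simp add: strip_def)
    have "(Re w)\<^sup>2 \<le> (1/2)\<^sup>2" using rw abs_le_square_iff[of "Re w" "1/2"] by simp
    then have "1 + (norm w)\<^sup>2 \<le> 2 + (Im z)\<^sup>2" unfolding cmod_power2 by (simp add: w_def power2_eq_square)
    also have "\<dots> \<le> 2 * (1 + (norm z)\<^sup>2)"
      unfolding cmod_power2 distrib_left mult_1_right by (intro add_mono) (auto intro: add_increasing)
    finally have "1 + (norm w)\<^sup>2 \<le> 2 * (1 + (norm z)\<^sup>2)" .
    then have "(1 + (norm w)\<^sup>2) / Im z \<le> 2 * (1 + (norm z)\<^sup>2) / Im z" using im by (intro divide_right_mono) auto
    then have hw: "hgt w \<le> 2 * H" by (simp add: hgt_def H_def w_def)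
    have "\<bar>Re z\<bar> \<le> H" using hgt_bounds(5)[OF im(1)] by (simp add: H_def)
    then have nH: "1 + real_of_int \<bar>n\<bar> \<le> 2 * H" using fl[of z] H2 unfolding n_def[symmetric] by linarith
    \<comment> \<open>The cube collects the square of the shift length 1 + |j| and the height of w,
      each at most 2 H.\<close>
    have gj: "norm (g (w + of_int j)) \<le> K1 * (16 * H ^ 3) ^ N1" if j: "\<bar>j\<bar> \<le> \<bar>n\<bar>" for j
    proof -
      have "hgt (w + of_real (of_int j)) \<le> 2 * (1 + \<bar>real_of_int j\<bar>)\<^sup>2 * hgt w"
        by (rule hgt_add_real_le[OF im(2)])
      also have "\<dots> \<le> 2 * (2 * H)\<^sup>2 * (2 * H)"
        using j nH hw H2 hgt_bounds(1)[OF im(2)] by (intro mult_mono mult_left_mono power_mono) auto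
      also have "\<dots> = 16 * H ^ 3" by (simp add: power2_eq_square power3_eq_cube)
      finally have h16: "hgt (w + of_int j) \<le> 16 * H ^ 3" by simp
      have "norm (g (w + of_int j)) \<le> K1 * hgt (w + of_int j) ^ N1" using K1[of "w + of_int j" N1] im by simp
      also have "\<dots> \<le> K1 * (16 * H ^ 3) ^ N1"
        using h16 gh hgt_bounds(1)[of "w + of_int j"] im by (intro mult_left_mono power_mono) auto
      finally show ?thesis .
    qed
    have "norm (F z) = norm (f w + orbit_sum \<mu> g n w)"
      by (simp add: F_def \<Phi>_def w_def n_def norm_mult norm_power_int \<mu>)
    also have "\<dots> \<le> norm (f w) + norm (orbit_sum \<mu> g n w)" by (rule norm_triangle_ineq)
    also have "\<dots> \<le> K2 * (2 * H) ^ N2 + of_int \<bar>n\<bar> * (K1 * (16 * H ^ 3) ^ N1)"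
    proof (rule add_mono)
      have "norm (f w) \<le> K2 * hgt w ^ N2" using K2[OF ws, of N2] by simp
      also have "\<dots> \<le> K2 * (2 * H) ^ N2"
        using fh hw hgt_bounds(1)[OF im(2)] by (intro mult_left_mono power_mono) auto
      finally show "norm (f w) \<le> K2 * (2 * H) ^ N2" .
      show "norm (orbit_sum \<mu> g n w) \<le> of_int \<bar>n\<bar> * (K1 * (16 * H ^ 3) ^ N1)"
        by (rule norm_orbit_sum_le[OF \<mu>]) (rule gj)
    qed
    also have "\<dots> \<le> K2 * (2 * H) ^ N2 + (2 * H) * (K1 * (16 * H ^ 3) ^ N1)"
      using nH gh H2 by (intro add_left_mono mult_right_mono) auto
    also have "\<dots> = K2 * 2 ^ N2 * H ^ N2 + 2 * K1 * 16 ^ N1 * H ^ (3 * N1 + 1)"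
      by (simp add: power_mult_distrib power_mult)
    also have "\<dots> \<le> K2 * 2 ^ N2 * H ^ max N2 (3 * N1 + 1) + 2 * K1 * 16 ^ N1 * H ^ max N2 (3 * N1 + 1)"
      using H2 gh fh by (intro add_mono mult_left_mono power_increasing) auto
    finally show ?thesis by (simp add: H_def distrib_right)
  qed
  ultimately have "moderate_on \<H> F" by (rule moderate_onI)
  moreover have "\<mu> * F (z + 1) - F z = g z" if "z \<in> \<H>" for z
  proof -
    define n where "n = \<lfloor>Re z + 1/2\<rfloor>"
    \<comment> \<open>z and z + 1 therefore share the base point z - n, and their orbit sums differ
      by exactly one step.\<close>
    have "\<lfloor>Re (z + 1) + 1/2\<rfloor> = n + 1" unfolding n_def by (simp add: floor_eq_iff) linarith
    then have "F (z + 1) = \<mu> powi (- (n + 1)) * (f (z - of_int n) + orbit_sum \<mu> g (n + 1) (z - of_int n))"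
      by (simp add: F_def \<Phi>_def)
    then have "\<mu> * F (z + 1) = (\<mu> powi (- (n + 1)) * \<mu>) * (f (z - of_int n) + orbit_sum \<mu> g (n + 1) (z - of_int n))"
      by simp
    also have "\<mu> powi (- (n + 1)) * \<mu> = \<mu> powi (- n)"
      using power_int_add_1[of \<mu> "- (n + 1)"] \<mu>0 by simp
    finally have "\<mu> * F (z + 1) = F z + (\<mu> powi (- n) * \<mu> powi n) * g z"
      unfolding orbit_sum_step[OF \<mu>0] by (simp add: F_def \<Phi>_def n_def[symmetric] algebra_simps)
    also have "\<mu> powi (- n) * \<mu> powi n = 1" using \<mu>0 by (simp add: power_int_minus)
    finally show ?thesis by simp
  qed
  ultimately show ?thesis by blast
qed

lemma difference_equation_unit_shift:
  assumes g: "moderate_on \<H> g" and \<mu>: "norm \<mu> = 1"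
  shows "\<exists>f. moderate_on \<H> f \<and> (\<forall>z\<in>\<H>. \<mu> * f (z + 1) - f z = g z)"
proof -
  \<comment> \<open>Passing from t to its fractional part changes the exponent by a multiple of 2 pi
    i and puts \<theta> into [0,1), as the kernel requires.\<close>
  define t where "t = - Arg \<mu> / (2 * pi)"
  have "exp (- (of_real (2 * pi * frac t) * \<i>)) = cis (- (2 * pi * frac t))" by (simp add: cis_conv_exp mult.commute)
  also have "- (2 * pi * frac t) = Arg \<mu> + 2 * pi * of_int \<lfloor>t\<rfloor>" by (simp add: frac_def t_def field_simps)
  also have "cis \<dots> = cis (Arg \<mu>) * cis (2 * pi * of_int \<lfloor>t\<rfloor>)" by (rule cis_mult[symmetric])
  also have "\<dots> = \<mu>"
  proof -
    have "\<mu> \<noteq> 0" using \<mu> by auto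
    then show ?thesis using \<mu> cis_Arg[of \<mu>] by (simp add: sgn_eq)
  qed
  finally have e: "exp (- (of_real (2 * pi * frac t) * \<i>)) = \<mu>" .
  obtain f where "moderate_on strip f" "\<forall>z. z \<in> strip \<longrightarrow> z + 1 \<in> strip \<longrightarrow> \<mu> * f (z + 1) - f z = g z"
    using difference_equation_strip[OF g frac_ge_0 frac_lt_1, of t] unfolding e by blast
  then show ?thesis using difference_equation_extend[OF g _ \<mu>] by blast
qed

lemma difference_equation_pos_shift:
  assumes g: "moderate_on \<H> g" and \<mu>: "norm \<mu> = 1" and h: "h > 0"
  shows "\<exists>f. moderate_on \<H> f \<and> (\<forall>z\<in>\<H>. \<mu> * f (z + of_real h) - f z = g z)"
proof -
  have "moderate_on \<H> (\<lambda>z. g (of_real h * z))"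
    using moderate_on_moebius[OF g order_refl order_refl, of h 1 0 0] h by simp
  then obtain F where F: "moderate_on \<H> F" "\<And>z. z \<in> \<H> \<Longrightarrow> \<mu> * F (z + 1) - F z = g (of_real h * z)"
    using difference_equation_unit_shift[OF _ \<mu>] by blast
  have "moderate_on \<H> (\<lambda>z. F (z / of_real h))"
    using moderate_on_moebius[OF F(1) order_refl order_refl, of 1 h 0 0] h by simp
  moreover have "\<mu> * F ((z + of_real h) / of_real h) - F (z / of_real h) = g z" if "z \<in> \<H>" for z
    using F(2)[of "z / of_real h"] that h by (simp add: add_divide_distrib)
  ultimately show ?thesis by (intro exI[of _ "\<lambda>z. F (z / of_real h)"]) auto
qed

text \<open>A negative shift is reduced to a positive one by evaluating at z - h and dividing by
  \<open>- \<mu>\<close>. Both signs are needed: the translation length of a parabolic element can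
  have either, and the matrix equation uses the inverse translation.\<close>

lemma difference_equation:
  assumes g: "moderate_on \<H> g" and \<mu>: "norm \<mu> = 1" and h: "h \<noteq> 0"
  shows "\<exists>f. moderate_on \<H> f \<and> (\<forall>z\<in>\<H>. \<mu> * f (z + of_real h) - f z = g z)"
proof (cases "h > 0")
  case False
  have \<mu>0: "\<mu> \<noteq> 0" using \<mu> by auto
  have "moderate_on \<H> (\<lambda>z. - inverse \<mu> * g (z + of_real (- h)))"
    by (intro moderate_on_cmult moderate_on_translate[OF g]) auto
  then obtain f where f: "moderate_on \<H> f"
     "\<And>z. z \<in> \<H> \<Longrightarrow> inverse \<mu> * f (z + of_real (- h)) - f z = - inverse \<mu> * g (z + of_real (- h))"
    using difference_equation_pos_shift[of _ "inverse \<mu>" "- h"] \<mu> h False by (auto simp: norm_inverse)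
  have "\<mu> * f (z + of_real h) - f z = g z" if "z \<in> \<H>" for z
  proof -
    have "inverse \<mu> * f z - f (z + of_real h) = - inverse \<mu> * g z" using f(2)[of "z + of_real h"] that by simp
    then have "\<mu> * (inverse \<mu> * f z - f (z + of_real h)) = \<mu> * (- inverse \<mu> * g z)" by simp
    then have "(\<mu> * inverse \<mu>) * f z - \<mu> * f (z + of_real h) = - (\<mu> * inverse \<mu>) * g z"
      by (simp only: right_diff_distrib mult.assoc mult_minus_left mult_minus_right)
    then show ?thesis using \<mu>0 by (simp add: algebra_simps)
  qed
  then show ?thesis using f(1) by blast
qed (use difference_equation_pos_shift[OF g \<mu>] in blast)

subsection \<open>The difference equation with a unitary matrix\<close>

definition ctrans :: "complex^'n^'n \<Rightarrow> complex^'n^'n" where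
  "ctrans A = transpose (map_matrix cnj A)"

lemma mat_mult_nth: "(mat c ** A) $ i $ j = c * A $ i $ j" for A :: "complex^'n^'n"
  by (simp add: matrix_matrix_mult_def mat_def if_distrib if_distribR cong: if_cong)

lemma mult_mat_nth: "(A ** mat c) $ i $ j = c * A $ i $ j" for A :: "complex^'n^'n"
  by (simp add: matrix_matrix_mult_def mat_def if_distrib if_distribR mult.commute cong: if_cong)

lemma mat_commute: "mat c ** A = A ** mat c" for A :: "complex^'n^'n"
  by (simp add: vec_eq_iff mat_mult_nth mult_mat_nth)

lemma ctrans_mult: "ctrans (A ** B) = ctrans B ** ctrans A"
  by (simp add: ctrans_def vec_eq_iff transpose_def matrix_matrix_mult_def mult.commute)

lemma ctrans_mat: "ctrans (mat c) = mat (cnj c)"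
  by (simp add: ctrans_def vec_eq_iff transpose_def mat_def)

text \<open>The columns of Y are eigenvectors or zero. Unitarity gives Y^H Y = |\<mu>|^2 Y^H Y for
  the conjugate transpose Y^H, and the diagonal entries of Y^H Y are the squared norms of the
  columns.\<close>

lemma unitary_eigenvalue:
  fixes U Y :: "complex^'n^'n"
  assumes "ctrans U ** U = mat 1" "U ** Y = mat \<mu> ** Y" "norm \<mu> \<noteq> 1"
  shows "Y = 0"
proof -
  have "ctrans Y ** Y = ctrans Y ** (ctrans U ** U) ** Y" by (simp add: assms(1))
  also have "\<dots> = ctrans (U ** Y) ** (U ** Y)" by (simp add: ctrans_mult matrix_mul_assoc)
  also have "\<dots> = ctrans Y ** (mat (cnj \<mu>) ** mat \<mu>) ** Y"
    unfolding assms(2) ctrans_mult ctrans_mat by (simp add: matrix_mul_assoc)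
  also have "mat (cnj \<mu>) ** mat \<mu> = (mat (cnj \<mu> * \<mu>) :: complex^'n^'n)"
    unfolding vec_eq_iff mat_mult_nth by (simp add: mat_def)
  also have "ctrans Y ** mat (cnj \<mu> * \<mu>) ** Y = mat (cnj \<mu> * \<mu>) ** (ctrans Y ** Y)"
    by (simp add: mat_commute[symmetric] matrix_mul_assoc)
  finally have e: "(ctrans Y ** Y) $ j $ j = (cnj \<mu> * \<mu>) * (ctrans Y ** Y) $ j $ j" for j
    by (metis mat_mult_nth)
  have "Y $ i $ j = 0" for i j
  proof -
    have "cnj \<mu> * \<mu> = of_real ((norm \<mu>)\<^sup>2)" by (simp add: complex_norm_square mult.commute del: of_real_power)
    moreover have "(norm \<mu>)\<^sup>2 \<noteq> 1" using assms(3) by (simp add: power2_eq_1_iff) (metis norm_ge_zero neg_0_le_iff_le not_one_le_zero)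
    ultimately have "cnj \<mu> * \<mu> \<noteq> 1" by (metis of_real_eq_1_iff)
    then have "(ctrans Y ** Y) $ j $ j = 0" using e[of j] by auto
    moreover have "(ctrans Y ** Y) $ j $ j = of_real (\<Sum>i\<in>UNIV. (norm (Y $ i $ j))\<^sup>2)"
      by (simp add: ctrans_def transpose_def matrix_matrix_mult_def complex_norm_square mult.commute del: of_real_power)
    ultimately have "(\<Sum>i\<in>UNIV. (norm (Y $ i $ j))\<^sup>2) = 0" by (metis of_real_eq_0_iff)
    then show ?thesis by (simp add: sum_nonneg_eq_0_iff)
  qed
  then show ?thesis by (simp add: vec_eq_iff)
qed

definition matrix_poly :: "complex^'n^'n \<Rightarrow> complex poly \<Rightarrow> complex^'n^'n" where
  "matrix_poly U q = fold_coeffs (\<lambda>a M. mat a + U ** M) q 0"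

lemma matrix_poly_0 [simp]: "matrix_poly U 0 = 0"
  by (simp add: matrix_poly_def)

lemma matrix_mult_zero_right [simp]: "A ** 0 = (0 :: complex^'n^'n)" for A :: "complex^'n^'n"
  by (simp add: vec_eq_iff matrix_matrix_mult_def)

lemma matrix_mult_zero_left [simp]: "0 ** A = (0 :: complex^'n^'n)" for A :: "complex^'n^'n"
  by (simp add: vec_eq_iff matrix_matrix_mult_def)

lemma matrix_poly_pCons [simp]: "matrix_poly U (pCons a q) = mat a + U ** matrix_poly U q"
  by (cases "a = 0 \<and> q = 0") (auto simp: matrix_poly_def)

lemma matrix_poly_add: "matrix_poly U (p + q) = matrix_poly U p + matrix_poly U q"
proof (induction p q rule: poly_induct2)
  case (pCons a p b q)
  have "(mat (a + b) :: complex^'a^'a) = mat a + mat b" by (simp add: vec_eq_iff mat_def)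
  then show ?case by (simp add: pCons.IH matrix_add_ldistrib)
qed simp

lemma matrix_poly_smult: "matrix_poly U (smult c q) = mat c ** matrix_poly U q"
proof (induction q)
  case (pCons a q)
  have "(mat (c * a) :: complex^'a^'a) = mat c ** mat a"
    unfolding vec_eq_iff mat_mult_nth by (simp add: mat_def)
  moreover have "U ** (mat c ** matrix_poly U q) = mat c ** (U ** matrix_poly U q)"
    by (simp only: matrix_mul_assoc mat_commute[of c U])
  ultimately show ?case by (simp add: pCons.IH matrix_add_ldistrib)
qed simp

lemma matrix_sum_rdistrib: "(A + B) ** C = A ** C + B ** C" for A :: "complex^'n^'n"
  by (simp add: vec_eq_iff matrix_matrix_mult_def distrib_right sum.distrib)

lemma matrix_poly_mult: "matrix_poly U (p * q) = matrix_poly U p ** matrix_poly U q"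
proof (induction p)
  case (pCons a p)
  then show ?case
    by (simp add: matrix_poly_add matrix_poly_smult matrix_sum_rdistrib matrix_mul_assoc)
qed simp

lemma matrix_poly_monom: "matrix_poly U (monom c n) = mat c ** (((**) U) ^^ n) (mat 1)"
proof (induction n)
  case (Suc n)
  have "U ** (mat c ** (((**) U) ^^ n) (mat 1)) = mat c ** (U ** (((**) U) ^^ n) (mat 1))"
    by (simp only: matrix_mul_assoc mat_commute[of c U])
  then show ?case by (simp add: monom_Suc Suc.IH)
qed (simp add: monom_0)

lemma matrix_poly_sum: "matrix_poly U (\<Sum>i\<in>I. q i) = (\<Sum>i\<in>I. matrix_poly U (q i))"
  by (induction I rule: infinite_finite_induct) (simp_all add: matrix_poly_add)

text \<open>More powers of U than the real dimension of the matrix space must be linearly dependent.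
  Dependence is a property of the set of powers, so a coincidence of two powers is treated
  separately, by the difference of two monomials.\<close>

lemma annihilating_poly_exists:
  fixes U :: "complex^'n^'n"
  shows "\<exists>q. q \<noteq> 0 \<and> matrix_poly U q = 0"
proof -
  define P where "P n = (((**) U) ^^ n) (mat 1)" for n
  define D where "D = DIM(complex^'n^'n)"
  show ?thesis
  proof (cases "inj_on P {..D}")
    case True
    have "card (P ` {..D}) = Suc D" by (simp add: card_image[OF True])
    then have "dependent (P ` {..D})"
      by (intro dependent_biggerset) (simp only: D_def[symmetric] lessI)
    then obtain u i where i: "i \<le> D" "u (P i) \<noteq> 0" and s: "(\<Sum>v\<in>P ` {..D}. u v *\<^sub>R v) = 0"
      by (auto simp: dependent_finite)
    define q where "q = (\<Sum>i\<le>D. monom (of_real (u (P i))) i :: complex poly)"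
    have "coeff q i = of_real (u (P i))" using i by (simp add: q_def coeff_sum)
    then have "q \<noteq> 0" using i by auto
    moreover have "matrix_poly U q = (\<Sum>i\<le>D. u (P i) *\<^sub>R P i)"
      unfolding q_def matrix_poly_sum matrix_poly_monom P_def[symmetric]
      by (intro sum.cong refl) (simp add: vec_eq_iff mat_mult_nth scaleR_conv_of_real[where 'a = complex])
    then have "matrix_poly U q = 0" using s by (simp add: sum.reindex[OF True])
    ultimately show ?thesis by blast
  next
    case False
    then obtain i j where ij: "P i = P j" "i \<noteq> j" by (auto simp: inj_on_def)
    define q :: "complex poly" where "q = monom 1 i + monom (-1) j"
    have "coeff q i = 1" using ij by (simp add: q_def)
    then have "q \<noteq> 0" by auto
    moreover have "matrix_poly U q = 0"
      unfolding q_def matrix_poly_add matrix_poly_monom P_def[symmetric] ij(1)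
      by (simp add: vec_eq_iff mat_mult_nth)
    ultimately show ?thesis by blast
  qed
qed

definition root_prod :: "complex^'n^'n \<Rightarrow> complex list \<Rightarrow> complex^'n^'n" where
  "root_prod U ms = foldr (\<lambda>\<mu> M. (U - mat \<mu>) ** M) ms (mat 1)"

lemma root_prod_append: "root_prod U (ms @ [\<mu>]) = root_prod U ms ** (U - mat \<mu>)"
  by (induction ms) (simp_all add: root_prod_def matrix_mul_assoc)

lemma matrix_diff_rdistrib: "(A - B) ** C = A ** C - B ** C" for A :: "complex^'n^'n"
  by (simp add: vec_eq_iff matrix_matrix_mult_def left_diff_distrib sum_subtractf)

text \<open>Linear factors are split off one at a time. A root off the unit circle is dropped, since
  \<open>unitary_eigenvalue\<close> cancels its factor. The arbitrary matrix X lets the induction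
  move a retained factor from the polynomial into the argument.\<close>

lemma unimodular_roots:
  fixes U :: "complex^'n^'n"
  assumes U: "ctrans U ** U = mat 1" and "q \<noteq> 0"
  shows "\<exists>ms. (\<forall>\<mu>\<in>set ms. norm \<mu> = 1) \<and> (\<forall>X :: complex^'n^'n. matrix_poly U q ** X = 0 \<longrightarrow> root_prod U ms ** X = 0)"
  using assms(2)
proof (induction "degree q" arbitrary: q rule: less_induct)
  case less
  show ?case
  proof (cases "degree q = 0")
    case True
    then obtain c where c: "q = [:c:]" using degree_eq_zeroE by blast
    then have "c \<noteq> 0" using less.prems by auto
    then have "X = 0" if "matrix_poly U q ** X = 0" for X :: "complex^'n^'n"
      using that by (simp add: c vec_eq_iff mat_mult_nth)
    then show ?thesis by (intro exI[of _ "[]"]) (auto simp: root_prod_def)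
  next
    case False
    then obtain \<mu> where "poly q \<mu> = 0"
      using fundamental_theorem_of_algebra[of q] constant_degree[of q] by auto
    then obtain r where r: "q = [:- \<mu>, 1:] * r" using poly_eq_0_iff_dvd by (metis dvdE)
    have r0: "r \<noteq> 0" using less.prems r by auto
    have "degree q = Suc (degree r)" unfolding r using r0 by (subst degree_mult_eq) auto
    then obtain ms where ms: "\<forall>\<mu>\<in>set ms. norm \<mu> = 1" "\<And>X :: complex^'n^'n. matrix_poly U r ** X = 0 \<Longrightarrow> root_prod U ms ** X = 0"
      using less.hyps[of r] r0 by auto
    have "mat (- \<mu>) = (- mat \<mu> :: complex^'n^'n)" by (simp add: vec_eq_iff mat_def)
    then have lin: "matrix_poly U [:- \<mu>, 1:] = U - mat \<mu>" by simp
    show ?thesis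
    proof (cases "norm \<mu> = 1")
      case True
      have "root_prod U (ms @ [\<mu>]) ** X = 0" if "matrix_poly U q ** X = 0" for X :: "complex^'n^'n"
      proof -
        have "q = r * [:- \<mu>, 1:]" using r by (simp only: mult.commute)
        then have "matrix_poly U r ** ((U - mat \<mu>) ** X) = 0"
          using that by (simp only: matrix_poly_mult lin matrix_mul_assoc)
        then have "root_prod U ms ** ((U - mat \<mu>) ** X) = 0" by (rule ms(2))
        then show ?thesis by (simp only: root_prod_append matrix_mul_assoc)
      qed
      then show ?thesis using ms(1) True by (intro exI[of _ "ms @ [\<mu>]"]) auto
    next
      case False
      have "matrix_poly U r ** X = 0" if "matrix_poly U q ** X = 0" for X :: "complex^'n^'n"
      proof (rule unitary_eigenvalue[OF U _ False])
        have "(U - mat \<mu>) ** (matrix_poly U r ** X) = 0"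
          using that unfolding r matrix_poly_mult lin by (simp add: matrix_mul_assoc)
        then show "U ** (matrix_poly U r ** X) = mat \<mu> ** (matrix_poly U r ** X)"
          by (simp add: matrix_diff_rdistrib)
      qed
      then show ?thesis using ms by blast
    qed
  qed
qed

definition vmoderate :: "(complex \<Rightarrow> complex^'n) \<Rightarrow> bool" where
  "vmoderate f \<longleftrightarrow> (\<forall>j. moderate_on \<H> (\<lambda>z. f z $ j))"

lemma vmoderate_add: "vmoderate f \<Longrightarrow> vmoderate g \<Longrightarrow> vmoderate (\<lambda>z. f z + g z)"
  by (simp add: vmoderate_def moderate_on_add)

lemma vmoderate_matrix: "vmoderate f \<Longrightarrow> vmoderate (\<lambda>z. A *v f z)"
  unfolding vmoderate_def matrix_vector_mult_def by (auto intro!: moderate_on_sum moderate_on_cmult)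

lemma vmoderate_translate: "vmoderate f \<Longrightarrow> vmoderate (\<lambda>z. f (z + of_real h))"
  unfolding vmoderate_def by (intro allI moderate_on_translate[OF _ order_refl order_refl]) auto

text \<open>Writing \<open>T\<close> for the translation, one can solve \<open>(U T - 1) f = g\<close> modulo the image of any
  product \<open>P\<close> of factors \<open>U - \<mu>\<close>: if \<open>h = (T\<^sup>-\<^sup>1 - \<mu>) h'\<close>, then
  \<open>P h = (U - \<mu>) P h' - (U T - 1) P T\<^sup>-\<^sup>1 h'\<close>.\<close>

lemma difference_equation_unitary:
  fixes U :: "complex^'n^'n"
  assumes U: "ctrans U ** U = mat 1" and g: "vmoderate g" and \<eta>: "\<eta> \<noteq> 0"
  shows "\<exists>f. vmoderate f \<and> (\<forall>z\<in>\<H>. U *v f (z + of_real \<eta>) - f z = g z)"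
proof -
  obtain q where q: "q \<noteq> 0" "matrix_poly U q = 0" using annihilating_poly_exists by blast
  obtain ms where ms: "\<forall>\<mu>\<in>set ms. norm \<mu> = 1"
      "\<forall>X :: complex^'n^'n. matrix_poly U q ** X = 0 \<longrightarrow> root_prod U ms ** X = 0"
    using unimodular_roots[OF U q(1)] by blast
  have "\<exists>f h. vmoderate f \<and> vmoderate h \<and>
      (\<forall>z\<in>\<H>. U *v f (z + of_real \<eta>) - f z - g z = root_prod U ms *v h z)"
    using ms(1)
  proof (induction ms)
    case Nil
    \<comment> \<open>The empty product is the identity, so f = 0 with remainder h = -g is a valid
      start.\<close>
    have "vmoderate (\<lambda>z. mat (- 1) *v g z)" by (rule vmoderate_matrix[OF g])
    moreover have "mat (- 1) *v v = - v" for v :: "complex^'n"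
      by (simp add: vec_eq_iff matrix_vector_mult_def mat_def if_distrib if_distribR cong: if_cong)
    moreover have "vmoderate (\<lambda>z. 0)" by (simp add: vmoderate_def moderate_on_const)
    ultimately show ?case
      by (intro exI[of _ "\<lambda>z. 0"] exI[of _ "\<lambda>z. mat (- 1) *v g z"]) (simp add: root_prod_def)
  next
    case (Cons \<mu> ms)
    then obtain f h where f: "vmoderate f" and h: "vmoderate h"
      and eq: "\<And>z. z \<in> \<H> \<Longrightarrow> U *v f (z + of_real \<eta>) - f z - g z = root_prod U ms *v h z"
      by auto
    have \<mu>: "norm \<mu> = 1" using Cons.prems by simp
    then have \<mu>0: "\<mu> \<noteq> 0" by auto
    \<comment> \<open>This is h = (T^-1 - \<mu>) h' in each coordinate, divided by \<mu> to give it
      the shape of the scalar equation.\<close>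
    have "\<exists>h'. moderate_on \<H> h' \<and> (\<forall>z\<in>\<H>. inverse \<mu> * h' (z + of_real (- \<eta>)) - h' z = inverse \<mu> * h z $ j)" for j
      by (rule difference_equation) (use h \<mu> \<eta> in \<open>auto simp: vmoderate_def norm_inverse intro!: moderate_on_cmult\<close>)
    then obtain k where k: "\<And>j. moderate_on \<H> (k j)"
      "\<And>j z. z \<in> \<H> \<Longrightarrow> inverse \<mu> * k j (z + of_real (- \<eta>)) - k j z = inverse \<mu> * h z $ j"
      by metis
    define h' where "h' z = (\<chi> j. k j z)" for z
    have h': "vmoderate h'" using k(1) by (simp add: vmoderate_def h'_def)
    have hh: "h z = h' (z + of_real (- \<eta>)) - \<mu> *s h' z" if "z \<in> \<H>" for z
    proof -
      have "h z $ j = k j (z + of_real (- \<eta>)) - \<mu> * k j z" for j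
      proof -
        have "\<mu> * (inverse \<mu> * k j (z + of_real (- \<eta>)) - k j z) = \<mu> * (inverse \<mu> * h z $ j)"
          using k(2)[OF that] by simp
        then have "(\<mu> * inverse \<mu>) * k j (z + of_real (- \<eta>)) - \<mu> * k j z = (\<mu> * inverse \<mu>) * h z $ j"
          by (simp only: right_diff_distrib mult.assoc)
        then show ?thesis using \<mu>0 by simp
      qed
      then show ?thesis by (simp add: vec_eq_iff h'_def)
    qed
    define P where "P = root_prod U ms"
    \<comment> \<open>Adding P T^-1 h' replaces the remainder P h by (U - \<mu>) P h', a product
      with one more factor.\<close>
    define f' where "f' z = f z + P *v h' (z + of_real (- \<eta>))" for z
    have "vmoderate f'" unfolding f'_def
      by (intro vmoderate_add f vmoderate_matrix vmoderate_translate h')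
    moreover have "U *v f' (z + of_real \<eta>) - f' z - g z = root_prod U (\<mu> # ms) *v h' z" if z: "z \<in> \<H>" for z
    proof -
      have "U *v f' (z + of_real \<eta>) - f' z - g z =
          (U *v f (z + of_real \<eta>) - f z - g z) + U *v (P *v h' z) - P *v h' (z + of_real (- \<eta>))"
        by (simp add: f'_def matrix_vector_right_distrib algebra_simps)
      also have "\<dots> = P *v (h' (z + of_real (- \<eta>)) - \<mu> *s h' z) + U *v (P *v h' z) - P *v h' (z + of_real (- \<eta>))"
        unfolding eq[OF z] hh[OF z] P_def ..
      also have "\<dots> = U *v (P *v h' z) - P *v (\<mu> *s h' z)"
        by (simp add: matrix_vector_mult_diff_distrib)
      also have "P *v (\<mu> *s h' z) = mat \<mu> *v (P *v h' z)"
        by (simp add: vec_eq_iff matrix_vector_mult_def mat_def if_distrib if_distribR sum_distrib_left mult_ac cong: if_cong)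
      also have "U *v (P *v h' z) - mat \<mu> *v (P *v h' z) = (U - mat \<mu>) *v (P *v h' z)"
        by (simp add: matrix_vector_mult_diff_rdistrib)
      also have "\<dots> = root_prod U (\<mu> # ms) *v h' z"
        by (simp add: root_prod_def P_def matrix_vector_mul_assoc)
      finally show ?thesis .
    qed
    ultimately show ?case using h' by blast
  qed
  then obtain f h where "vmoderate f" "\<And>z. z \<in> \<H> \<Longrightarrow> U *v f (z + of_real \<eta>) - f z - g z = root_prod U ms *v h z"
    by blast
  \<comment> \<open>The list of roots came from a polynomial annihilating U, so the remainder
    vanishes after the last factor.\<close>
  moreover have "root_prod U ms = 0" using ms(2)[rule_format, of "mat 1"] q(2) by simp
  ultimately show ?thesis by (intro exI[of _ f]) (auto simp: algebra_simps)
qed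

subsection \<open>Parabolic elements\<close>

lemma powr_le_power:
  fixes x h a :: real
  assumes "0 < x" "x \<le> h" "1 \<le> h" "0 \<le> a" "a \<le> real N"
  shows "x powr a \<le> h ^ N"
proof -
  have "x powr a \<le> h powr a" using assms by (intro powr_mono2) auto
  also have "\<dots> \<le> h powr real N" using assms by (intro powr_mono) auto
  also have "\<dots> = h ^ N" using assms by (simp add: powr_realpow)
  finally show ?thesis .
qed

text \<open>\<open>hgt\<close> is a product of \<open>1 + (norm z)^2\<close> and
  \<open>1 / Im z\<close>, while \<open>PP\<close> wants a sum of powers; a product is at most the
  square of the larger factor, which doubles the exponents.\<close>

lemma hgt_power_le:
  assumes "Im z > 0"
  shows "hgt z ^ N \<le> (2 * 4 ^ N + 1) * (norm z ^ (4 * N) + (1 / Im z) ^ (2 * N))"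
proof -
  define a where "a = 1 + (norm z)\<^sup>2"
  \<comment> \<open>The additive constant 1 in a is absorbed by the sum of powers: either Im z is at
    most 1, and b is at least 1, or the norm of z exceeds 1.\<close>
  define b where "b = 1 / Im z"
  define r where "r = norm z"
  have a: "a \<ge> 1" "b > 0" using assms by (auto simp: a_def b_def)
  have r0: "r \<ge> 0" by (simp add: r_def)
  have one: "1 \<le> r ^ (4 * N) + b ^ (2 * N)"
  proof (cases "Im z \<le> 1")
    case True
    then have "1 \<le> b ^ (2 * N)" using assms by (intro one_le_power) (simp add: b_def)
    then show ?thesis using r0 by (simp add: add_increasing)
  next
    case False
    then have "1 \<le> r" using abs_Im_le_cmod[of z] by (simp add: r_def)
    then have "1 \<le> r ^ (4 * N)" by (rule one_le_power)
    then show ?thesis using a by (simp add: add_increasing2)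
  qed
  have "a * b \<le> (max a b)\<^sup>2" unfolding power2_eq_square using a by (intro mult_mono) auto
  then have "(a * b) ^ N \<le> ((max a b)\<^sup>2) ^ N" using a by (intro power_mono) auto
  also have "\<dots> = (max a b) ^ (2 * N)" by (simp add: power_mult)
  also have "\<dots> \<le> a ^ (2 * N) + b ^ (2 * N)" using a by (auto simp: max_def)
  also have "a ^ (2 * N) \<le> 4 ^ N * (1 + r ^ (4 * N))"
  proof -
    have "a \<le> 2 * max 1 (r\<^sup>2)" by (auto simp: a_def r_def max_def)
    then have "a ^ (2 * N) \<le> (2 * max 1 (r\<^sup>2)) ^ (2 * N)" using a by (intro power_mono) auto
    also have "\<dots> = 4 ^ N * max 1 (r\<^sup>2) ^ (2 * N)" by (simp add: power_mult_distrib power_mult)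
    also have "max 1 (r\<^sup>2) ^ (2 * N) \<le> 1 + r ^ (4 * N)"
    proof -
      have "(r\<^sup>2) ^ (2 * N) = r ^ (4 * N)" by (simp add: power_mult[symmetric])
      then show ?thesis using r0 by (auto simp: max_def)
    qed
    finally show ?thesis by simp
  qed
  also have "4 ^ N * (1 + r ^ (4 * N)) + b ^ (2 * N) \<le> 4 ^ N * ((r ^ (4 * N) + b ^ (2 * N)) + (r ^ (4 * N) + b ^ (2 * N))) + (r ^ (4 * N) + b ^ (2 * N))"
    using one r0 a by (intro add_mono mult_left_mono) auto
  also have "\<dots> = (2 * 4 ^ N + 1) * (r ^ (4 * N) + b ^ (2 * N))" by (simp add: algebra_simps)
  finally show ?thesis by (simp add: a_def b_def r_def hgt_def)
qed

lemma PP_iff_vmoderate: "G \<in> PP \<longleftrightarrow> (\<forall>\<tau>. \<tau> \<notin> \<H> \<longrightarrow> G \<tau> = 0) \<and> vmoderate G"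
  for G :: "complex \<Rightarrow> complex^'n"
proof
  assume G: "G \<in> PP"
  then obtain K \<alpha> \<sigma> where K: "K > 0" "\<alpha> > 0" "\<sigma> > 0"
    "\<And>j \<tau>. \<tau> \<in> \<H> \<Longrightarrow> norm (G \<tau> $ j) < K * (norm \<tau> powr \<alpha> + Im \<tau> powr (- \<sigma>))"
    unfolding PP_def by blast
  define N where "N = nat \<lceil>max \<alpha> \<sigma>\<rceil>"
  have N: "\<alpha> \<le> real N" "\<sigma> \<le> real N" unfolding N_def by linarith+
  have "moderate_on \<H> (\<lambda>z. G z $ j)" for j
  proof (rule moderate_onI[of _ _ "2 * K" N])
    show "(\<lambda>z. G z $ j) holomorphic_on \<H>" using G by (simp add: PP_def)
    fix z assume z: "z \<in> \<H>"
    then have im: "Im z > 0" by simp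
    note h = hgt_bounds[OF im]
    have "norm z powr \<alpha> \<le> hgt z ^ N" using h K N im by (intro powr_le_power) auto
    moreover have "Im z powr (- \<sigma>) \<le> hgt z ^ N"
    proof -
      have "Im z powr (- \<sigma>) = (1 / Im z) powr \<sigma>" using im by (simp add: powr_minus_divide powr_divide)
      also have "\<dots> \<le> hgt z ^ N" using h K N im by (intro powr_le_power) auto
      finally show ?thesis .
    qed
    ultimately have "K * (norm z powr \<alpha> + Im z powr (- \<sigma>)) \<le> K * (hgt z ^ N + hgt z ^ N)"
      using K by (intro mult_left_mono add_mono) auto
    then show "norm (G z $ j) \<le> 2 * K * hgt z ^ N" using K(4)[OF z, of j] by simp
  qed
  then show "(\<forall>\<tau>. \<tau> \<notin> \<H> \<longrightarrow> G \<tau> = 0) \<and> vmoderate G" using G by (auto simp: PP_def vmoderate_def)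
next
  assume G: "(\<forall>\<tau>. \<tau> \<notin> \<H> \<longrightarrow> G \<tau> = 0) \<and> vmoderate G"
  have "\<exists>K N. K > 0 \<and> (\<forall>z\<in>\<H>. \<forall>M\<ge>N. norm (G z $ j) \<le> K * hgt z ^ M)" for j
  proof -
    have "moderate_on \<H> (\<lambda>z. G z $ j)" using G by (simp add: vmoderate_def)
    then obtain K N where "K > 0" "\<And>z M. z \<in> \<H> \<Longrightarrow> N \<le> M \<Longrightarrow> norm (G z $ j) \<le> K * hgt z ^ M"
      using moderate_onE[OF _ order_refl] by metis
    then show ?thesis by blast
  qed
  then obtain K N where K: "\<And>j. K j > 0" "\<And>j z M. z \<in> \<H> \<Longrightarrow> N j \<le> M \<Longrightarrow> norm (G z $ j) \<le> K j * hgt z ^ M"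
    by metis
  \<comment> \<open>One exponent for all coordinates; the successor keeps \<alpha> and \<sigma>
    strictly positive.\<close>
  define M where "M = Suc (\<Sum>j\<in>UNIV. N j)"
  define L where "L = (\<Sum>j\<in>UNIV. K j)"
  define C where "C = L * (2 * 4 ^ M + 1)"
  have L: "K j \<le> L" for j unfolding L_def using K(1) by (intro member_le_sum) (auto intro: less_imp_le)
  have NM: "N j \<le> M" for j
    using member_le_sum[of j UNIV N] by (simp add: M_def)
  \<comment> \<open>C alone gives a weak inequality; the extra 1 makes it strict, as
    \<open>PP\<close> demands.\<close>
  have "norm (G z $ j) < (C + 1) * (norm z powr (real (4 * M)) + Im z powr (- real (2 * M)))" if z: "z \<in> \<H>" for z j
  proof -
    have im: "Im z > 0" using z by simp
    then have nz: "norm z > 0" by auto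
    have p: "norm z powr (real (4 * M)) = norm z ^ (4 * M)" by (rule powr_realpow[OF nz])
    have q: "Im z powr (- real (2 * M)) = (1 / Im z) ^ (2 * M)"
      using im by (simp only: powr_minus powr_realpow[OF im] power_one_over inverse_eq_divide)
    define S where "S = norm z ^ (4 * M) + (1 / Im z) ^ (2 * M)"
    have S: "S > 0" unfolding S_def using nz im by (intro add_pos_pos) auto
    have L0: "L > 0" using K(1)[of j] L[of j] by linarith
    have "norm (G z $ j) \<le> K j * hgt z ^ M" by (rule K(2)[OF z NM])
    also have "\<dots> \<le> L * hgt z ^ M" using L hgt_bounds(1)[OF im] by (intro mult_right_mono) auto
    also have "\<dots> \<le> L * ((2 * 4 ^ M + 1) * S)"
      unfolding S_def using L0 by (intro mult_left_mono hgt_power_le[OF im]) auto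
    also have "\<dots> < L * ((2 * 4 ^ M + 1) * S) + S" using S by simp
    also have "\<dots> = (C + 1) * S" by (simp only: C_def distrib_right mult_1 mult.assoc)
    finally show ?thesis unfolding p q S_def .
  qed
  moreover have "C + 1 > 0"
  proof -
    have "L \<ge> 0" unfolding L_def using K(1) by (intro sum_nonneg) (auto intro: less_imp_le)
    then have "C \<ge> 0" by (simp add: C_def)
    then show ?thesis by simp
  qed
  moreover have "M > 0" by (simp add: M_def)
  then have "real (4 * M) > 0" "real (2 * M) > 0" by simp_all
  ultimately have "\<exists>K>0. \<exists>\<alpha>>0. \<exists>\<sigma>>0. \<forall>j. \<forall>\<tau>\<in>\<H>. norm (G \<tau> $ j) < K * (norm \<tau> powr \<alpha> + Im \<tau> powr (- \<sigma>))"
    by blast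
  then show "G \<in> PP" using G by (auto simp: PP_def vmoderate_def moderate_on_def)
qed

lemma vmoderate_cong:
  assumes "vmoderate f" "\<And>z. z \<in> \<H> \<Longrightarrow> f z = g z"
  shows "vmoderate g"
  using assms unfolding vmoderate_def by (metis (no_types, lifting) moderate_on_cong)

lemma vmoderate_cutoff_PP: "vmoderate f \<Longrightarrow> (\<lambda>z. if z \<in> \<H> then f z else 0) \<in> PP"
  unfolding PP_iff_vmoderate by (auto elim!: vmoderate_cong)

lemma vmoderate_smult: "moderate_on \<H> c \<Longrightarrow> vmoderate f \<Longrightarrow> vmoderate (\<lambda>z. c z *s f z)"
  unfolding vmoderate_def by (auto intro: moderate_on_mult)

lemma vmoderate_moebius:
  fixes a b c d :: real
  assumes "vmoderate f" "a * d - b * c > 0"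
  shows "vmoderate (\<lambda>z. f ((of_real a * z + of_real b) / (of_real c * z + of_real d)))"
  unfolding vmoderate_def
proof
  fix j
  have "(of_real a * z + of_real b) / (of_real c * z + of_real d) \<in> \<H>" if "z \<in> \<H>" for z :: complex
    using hgt_moebius_le[OF assms(2)] that by blast
  then show "moderate_on \<H> (\<lambda>z. f ((of_real a * z + of_real b) / (of_real c * z + of_real d)) $ j)"
    using assms by (intro moderate_on_moebius[of \<H> "\<lambda>z. f z $ j"]) (auto simp: vmoderate_def)
qed

lemma matrix_inv_eq_ctrans:
  assumes "ctrans R ** R = mat 1" "R ** ctrans R = mat 1"
  shows "matrix_inv R = ctrans R"
proof -
  have "R ** matrix_inv R = mat 1 \<and> matrix_inv R ** R = mat 1"
    unfolding matrix_inv_def by (rule someI[of _ "ctrans R"]) (use assms in simp)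
  then show ?thesis by (metis assms(1) matrix_mul_assoc matrix_mul_lid matrix_mul_rid)
qed

text \<open>Off the real axis the chosen branch agrees with the principal logarithm, so holomorphic
  tools apply to the automorphy factor of any element with nonzero lower left entry.\<close>

lemma rpow_eq_exp_Ln:
  assumes "Im u \<noteq> 0"
  shows "rpow u k = exp (of_real k * Ln u)"
proof -
  have u: "u \<noteq> 0" using assms by auto
  have "Arg u \<noteq> pi" using assms by (simp add: Arg_eq_pi)
  then have "branch_arg u = Im (Ln u)" using Arg_eq_Im_Ln[OF u] by (simp add: branch_arg_def)
  moreover have "norm u powr k = exp (k * Re (Ln u))" using u by (simp add: powr_def)
  moreover have "exp (of_real k * Ln u) = of_real (exp (k * Re (Ln u))) * cis (k * Im (Ln u))"
    by (subst exp_eq_polar) simp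
  ultimately show ?thesis by (simp add: rpow_def)
qed

text \<open>The modulus is a power of |z - x|. For negative exponents it is controlled by 1 / |z|
  \<le> 1 / Im z after a real translation.\<close>

lemma moderate_on_Ln_power: "moderate_on \<H> (\<lambda>z. exp (of_real m * Ln (z - of_real x)))"
proof -
  define N where "N = nat \<lceil>\<bar>m\<bar>\<rceil>"
  have N: "\<bar>m\<bar> \<le> real N" unfolding N_def by linarith
  have "moderate_on \<H> (\<lambda>z. exp (of_real m * Ln z))"
  proof (rule moderate_onI[of _ _ 1 N])
    show "(\<lambda>z. exp (of_real m * Ln z)) holomorphic_on \<H>"
      by (intro holomorphic_intros) (auto simp: complex_nonpos_Reals_iff)
    fix z assume "z \<in> \<H>"
    then have im: "Im z > 0" by simp
    then have z: "z \<noteq> 0" by auto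
    note h = hgt_bounds[OF im]
    have "norm (exp (of_real m * Ln z)) = norm z powr m" using z by (simp add: norm_exp_eq_Re powr_def)
    also have "\<dots> \<le> hgt z ^ N"
    proof (cases "m \<ge> 0")
      case True
      then show ?thesis using h z N by (intro powr_le_power) auto
    next
      case False
      have "norm z powr m = (1 / norm z) powr (- m)" using z by (simp add: powr_minus_divide powr_divide)
      also have "\<dots> \<le> hgt z ^ N"
      proof (rule powr_le_power)
        have "1 / norm z \<le> 1 / Im z" using im abs_Im_le_cmod[of z] by (intro frac_le) auto
        then show "1 / norm z \<le> hgt z" using h by linarith
      qed (use h z N False in auto)
      finally show ?thesis .
    qed
    finally show "norm (exp (of_real m * Ln z)) \<le> 1 * hgt z ^ N" by simp
  qed
  then show ?thesis using moderate_on_translate[of \<H> "\<lambda>z. exp (of_real m * Ln z)" \<H> "- x"] by simp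
qed

text \<open>The two sides below are powers of numbers that differ by the constant factor
  \<open>\<epsilon>\<close>, so the logarithm of their quotient is locally constant.\<close>

lemma rpow_fixed_point:
  fixes c d x \<epsilon> k :: real
  assumes c: "c \<noteq> 0" and \<epsilon>: "\<bar>\<epsilon>\<bar> = 1"
    and im: "\<And>z. Im z > 0 \<Longrightarrow> Im ((z - of_real x) / (of_real \<epsilon> * (of_real c * z + of_real d))) > 0"
  shows "\<exists>j. norm j = 1 \<and> (\<forall>z\<in>\<H>. rpow (of_real c * z + of_real d) k *
      exp (of_real k * Ln ((z - of_real x) / (of_real \<epsilon> * (of_real c * z + of_real d)))) =
      j * exp (of_real k * Ln (z - of_real x)))"
proof -
  define u where "u z = of_real c * z + of_real d" for z :: complex
  define w where "w z = (z - of_real x) / (of_real \<epsilon> * u z)" for z :: complex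
  define L where "L z = Ln (u z) + Ln (w z) - Ln (z - of_real x)" for z
  have imu: "Im (u z) \<noteq> 0" if "z \<in> \<H>" for z using that c by (simp add: u_def)
  then have u0: "u z \<noteq> 0" if "z \<in> \<H>" for z using that by fastforce
  have imw: "Im (w z) > 0" if "z \<in> \<H>" for z using that im by (simp add: w_def u_def)
  then have w0: "w z \<noteq> 0" if "z \<in> \<H>" for z using that by fastforce
  have x0: "z - of_real x \<noteq> 0" if "z \<in> \<H>" for z
    using that by (metis Im_complex_of_real eq_iff_diff_eq_0 less_irrefl mem_Collect_eq)
  have \<epsilon>0: "\<epsilon> \<noteq> 0" using \<epsilon> by auto
  have "u holomorphic_on \<H>" unfolding u_def by (intro holomorphic_intros)
  moreover have "w holomorphic_on \<H>"
    unfolding w_def using u0 \<epsilon>0 \<open>u holomorphic_on \<H>\<close> by (intro holomorphic_intros) auto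
  moreover have "u z \<notin> \<real>\<^sub>\<le>\<^sub>0" "w z \<notin> \<real>\<^sub>\<le>\<^sub>0" "z - of_real x \<notin> \<real>\<^sub>\<le>\<^sub>0" if "z \<in> \<H>" for z
    using imu[OF that] imw[OF that] that by (auto simp: complex_nonpos_Reals_iff)
  ultimately have "L holomorphic_on \<H>"
    unfolding L_def by (intro holomorphic_intros) auto
  have eL: "exp (L z) = 1 / of_real \<epsilon>" if "z \<in> \<H>" for z
  proof -
    have "exp (L z) = u z * w z / (z - of_real x)"
      using u0[OF that] w0[OF that] x0[OF that] by (simp add: L_def exp_add exp_diff)
    also have "\<dots> = 1 / of_real \<epsilon>"
      using u0[OF that] x0[OF that] \<epsilon>0 by (simp add: w_def field_simps)
    finally show ?thesis .
  qed
  have "(L has_field_derivative 0) (at z within \<H>)" if z: "z \<in> \<H>" for z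
  proof -
    obtain D where D: "(L has_field_derivative D) (at z)"
      using \<open>L holomorphic_on \<H>\<close> z open_upper_half_plane by (auto simp: holomorphic_on_open)
    then have "((\<lambda>z. exp (L z)) has_field_derivative exp (L z) * D) (at z)"
      by (auto intro!: derivative_eq_intros)
    then have "((\<lambda>z. 1 / of_real \<epsilon>) has_field_derivative exp (L z) * D) (at z)"
      by (rule has_field_derivative_transform_within_open[OF _ open_upper_half_plane z]) (use eL in auto)
    then have "exp (L z) * D = 0" by (rule DERIV_unique) simp
    then have "D = 0" by simp
    then show ?thesis using D by (auto intro: has_field_derivative_at_within)
  qed
  moreover have "convex \<H>" using convex_halfspace_Im_gt[of 0] by simp
  ultimately obtain l where l: "\<forall>z\<in>\<H>. L z = l" using has_field_derivative_zero_constant by blast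
  \<comment> \<open>Any sample point shows |exp l| = 1, so l is purely imaginary and j = exp(k l) is
    unimodular.\<close>
  have "\<i> \<in> \<H>" by simp
  then have "exp l = 1 / of_real \<epsilon>" using eL l by metis
  then have "norm (exp l) = 1" using \<epsilon> by (simp add: norm_divide)
  then have "Re l = 0" by (simp add: norm_exp_eq_Re)
  then have "norm (exp (of_real k * l)) = 1" by (simp add: norm_exp_eq_Re)
  moreover have "rpow (u z) k * exp (of_real k * Ln (w z)) = exp (of_real k * l) * exp (of_real k * Ln (z - of_real x))"
    if z: "z \<in> \<H>" for z
  proof -
    have "Ln (u z) + Ln (w z) = l + Ln (z - of_real x)" using l z by (auto simp: L_def)
    then show ?thesis
      unfolding rpow_eq_exp_Ln[OF imu[OF z]] exp_add[symmetric] distrib_left[symmetric] by simp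
  qed
  ultimately show ?thesis unfolding u_def w_def by blast
qed

lemma unitary_scaled:
  assumes "norm \<kappa> = 1" "R ** ctrans R = mat 1"
  shows "ctrans (mat \<kappa> ** ctrans R) ** (mat \<kappa> ** ctrans R) = mat 1"
proof -
  have cc: "ctrans (ctrans R) = R" by (simp add: ctrans_def vec_eq_iff transpose_def)
  have "ctrans (mat \<kappa> ** ctrans R) ** (mat \<kappa> ** ctrans R) = R ** (mat (cnj \<kappa>) ** mat \<kappa>) ** ctrans R"
    by (simp add: ctrans_mult ctrans_mat cc matrix_mul_assoc)
  also have "cnj \<kappa> * \<kappa> = 1" using assms(1) by (metis complex_norm_square mult.commute of_real_1 one_power2)
  then have "mat (cnj \<kappa>) ** mat \<kappa> = (mat 1 :: complex^'a^'a)"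
    unfolding vec_eq_iff mat_mult_nth by (simp add: mat_def)
  finally show ?thesis using assms(2) by simp
qed

lemma mat_mult_vector: "mat \<kappa> *v x = \<kappa> *s x" for x :: "complex^'n"
  by (simp add: vec_eq_iff matrix_vector_mult_def mat_def if_distrib if_distribR cong: if_cong)

text \<open>If B fixes infinity it already acts as a translation with constant automorphy factor.
  Otherwise w = -1 / (z - x) sends its fixed point x to infinity, and dividing by (z - x)^k turns
  the automorphy factor into a unimodular constant. Either way the slash operator becomes a unitary
  matrix times a translation.\<close>

lemma parabolic_coboundary:
  fixes \<rho> :: "real^2^2 \<Rightarrow> complex^'p^'p"
  assumes B: "parabolic B" and chi: "norm (chi B) = 1"
    and R: "ctrans (\<rho> B) ** \<rho> B = mat 1" "\<rho> B ** ctrans (\<rho> B) = mat 1" and g: "g \<in> PP"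
  shows "\<exists>Q\<in>PP. g = slash k chi \<rho> Q B - Q"
proof -
  define a b c d where "a = B$1$1" and "b = B$1$2" and "c = B$2$1" and "d = B$2$2"
  have det: "a * d - b * c = 1" and tr: "\<bar>a + d\<bar> = 2"
    using B by (auto simp: parabolic_def det_2 trace_def sum_2 a_def b_def c_def d_def)
  have actB: "act B z = (of_real a * z + of_real b) / (of_real c * z + of_real d)" for z
    by (simp add: act_def moebius_def a_def b_def c_def d_def)
  have autB: "aut_denom B z = of_real c * z + of_real d" for z
    by (simp add: aut_denom_def c_def d_def)
  have inv: "matrix_inv (\<rho> B) = ctrans (\<rho> B)" by (rule matrix_inv_eq_ctrans[OF R])
  have g0: "g z = 0" if "z \<notin> \<H>" for z using g that by (simp add: PP_iff_vmoderate)
  have vg: "vmoderate g" using g by (simp add: PP_iff_vmoderate)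
  have act_H: "act B z \<in> \<H>" if "z \<in> \<H>" for z
    unfolding actB using hgt_moebius_le[of a d b c] det that by (metis (no_types) mem_Collect_eq zero_less_one)
  have fin: "\<exists>Q\<in>PP. g = slash k chi \<rho> Q B - Q"
    if f: "vmoderate f" and eq: "\<And>z. z \<in> \<H> \<Longrightarrow>
      (inverse (chi B) * rpow (of_real c * z + of_real d) k) *s (ctrans (\<rho> B) *v f (act B z)) - f z = g z" for f
  proof
    show "(\<lambda>z. if z \<in> \<H> then f z else 0) \<in> PP" by (rule vmoderate_cutoff_PP[OF f])
    show "g = slash k chi \<rho> (\<lambda>z. if z \<in> \<H> then f z else 0) B - (\<lambda>z. if z \<in> \<H> then f z else 0)"
    proof
      fix z
      show "g z = (slash k chi \<rho> (\<lambda>z. if z \<in> \<H> then f z else 0) B - (\<lambda>z. if z \<in> \<H> then f z else 0)) z"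
        using act_H[of z] eq[of z] g0[of z] by (simp add: slash_def inv autB)
    qed
  qed
  \<comment> \<open>The double eigenvalue of B, equal to 1 or -1.\<close>
  define \<epsilon> where "\<epsilon> = (a + d) / 2"
  have \<epsilon>: "\<bar>\<epsilon>\<bar> = 1" using tr by (simp add: \<epsilon>_def)
  then have \<epsilon>2: "\<epsilon> * \<epsilon> = 1" by (metis abs_mult_self_eq mult.left_neutral)
  show ?thesis
  proof (cases "c = 0")
    case True
    have "(a + d)\<^sup>2 = 4" using tr by (metis power2_abs power2_eq_square mult_2 numeral_Bit0 numeral_plus_numeral one_add_one mult_2_right)
    then have "(a - d)\<^sup>2 = 0" using det True by (simp add: power2_eq_square algebra_simps)
    \<comment> \<open>With c = 0 the determinant gives a d = 1, so (a - d)^2 = (a + d)^2 - 4 =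
      0.\<close>
    then have ad: "a = d" by simp
    then have d1: "\<bar>d\<bar> = 1" using tr by simp
    have "b \<noteq> 0"
    proof
      assume "b = 0"
      then have "B = mat 1 \<or> B = - mat 1"
        using True ad d1 by (auto simp: vec_eq_iff forall_2 mat_def a_def b_def c_def d_def abs_if split: if_splits)
      then show False using B by (simp add: parabolic_def)
    qed
    then have h: "b / d \<noteq> 0" using d1 by auto
    define \<kappa> where "\<kappa> = inverse (chi B) * rpow (of_real d) k"
    have "norm \<kappa> = 1" using chi d1 by (simp add: \<kappa>_def norm_mult norm_inverse rpow_def)
    then obtain f where f: "vmoderate f"
      "\<And>z. z \<in> \<H> \<Longrightarrow> (mat \<kappa> ** ctrans (\<rho> B)) *v f (z + of_real (b / d)) - f z = g z"
      using difference_equation_unitary[OF unitary_scaled[OF _ R(2)] vg h] by blast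
    show ?thesis
    proof (rule fin[OF f(1)])
      fix z assume z: "z \<in> \<H>"
      have "act B z = z + of_real (b / d)"
        using True ad d1 by (auto simp: actB field_simps)
      then show "(inverse (chi B) * rpow (of_real c * z + of_real d) k) *s (ctrans (\<rho> B) *v f (act B z)) - f z = g z"
        using f(2)[OF z] True by (simp add: \<kappa>_def mat_mult_vector matrix_vector_mul_assoc[symmetric])
    qed
  next
    case False
    \<comment> \<open>x is the double root of c x^2 + (d - a) x - b, the only fixed point of B, and
      h is the translation length of B in the coordinate w.\<close>
    define x where "x = (a - d) / (2 * c)"
    define h where "h = - \<epsilon> * c"
    have h: "h \<noteq> 0" using False \<epsilon> by (auto simp: h_def)
    have cx: "c * x + d = \<epsilon>" using False by (simp add: x_def \<epsilon>_def field_simps)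
    have den: "of_real c * z + of_real d \<noteq> (0::complex)" if "z \<in> \<H>" for z
      using that False by (auto simp: complex_eq_iff)
    have zx: "z - of_real x \<noteq> 0" if "z \<in> \<H>" for z
      using that by (metis Im_complex_of_real eq_iff_diff_eq_0 less_irrefl mem_Collect_eq)
    have fix1: "a - x * c = \<epsilon>" using False by (simp add: x_def \<epsilon>_def field_simps)
    \<comment> \<open>Together with \<open>fix1\<close> this says that the row (1, -x) is a left
      eigenvector of B for \<epsilon>, so the numerator of B z - x is \<epsilon> (z - x).\<close>
    have fix2: "b - x * d = - \<epsilon> * x"
    proof -
      have "c * (b - x * d) = c * (- \<epsilon> * x)"
      proof -
        have cx': "c * x = \<epsilon> - d" using cx by simp
        have "c * (- \<epsilon> * x) = - \<epsilon> * (c * x)" by simp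
        also have "\<dots> = - \<epsilon> * (\<epsilon> - d)" unfolding cx' ..
        also have "\<dots> = \<epsilon> * d - 1" using \<epsilon>2 by (simp add: algebra_simps)
        finally have 1: "c * (- \<epsilon> * x) = \<epsilon> * d - 1" .
        have "c * (b - x * d) = b * c - (c * x) * d" by (simp add: algebra_simps)
        also have "\<dots> = b * c - (\<epsilon> - d) * d" unfolding cx' ..
        also have "\<dots> = b * c - \<epsilon> * d + d * d" by (simp add: algebra_simps)
        also have "\<dots> = \<epsilon> * d - 1" using det by (simp add: \<epsilon>_def field_simps)
        finally show ?thesis using 1 by simp
      qed
      then show ?thesis by (simp only: mult_left_cancel[OF False])
    qed
    have actx: "act B z - of_real x = (z - of_real x) / (of_real \<epsilon> * (of_real c * z + of_real d))" if z: "z \<in> \<H>" for z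
    proof -
      have "act B z - of_real x = (of_real (a - x * c) * z + of_real (b - x * d)) / (of_real c * z + of_real d)"
        using den[OF z] by (simp add: actB field_simps)
      also have "\<dots> = of_real \<epsilon> * (z - of_real x) / (of_real c * z + of_real d)"
        unfolding fix1 fix2 by (simp add: algebra_simps)
      also have "of_real \<epsilon> = (1 / of_real \<epsilon> :: complex)"
        using \<epsilon>2 \<epsilon> by (auto simp: field_simps simp flip: of_real_mult)
      finally show ?thesis by simp
    qed
    have "\<And>z. Im z > 0 \<Longrightarrow> Im ((z - of_real x) / (of_real \<epsilon> * (of_real c * z + of_real d))) > 0"
      using actx act_H by (metis Im_complex_of_real diff_zero mem_Collect_eq minus_complex.simps(2))
    then obtain j where j: "norm j = 1"
      "\<And>z. z \<in> \<H> \<Longrightarrow> rpow (of_real c * z + of_real d) k *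
        exp (of_real k * Ln ((z - of_real x) / (of_real \<epsilon> * (of_real c * z + of_real d)))) =
        j * exp (of_real k * Ln (z - of_real x))"
      using rpow_fixed_point[OF False \<epsilon>, of x d k] by blast
    define \<kappa> where "\<kappa> = inverse (chi B) * j"
    have \<kappa>: "norm \<kappa> = 1" using chi j by (simp add: \<kappa>_def norm_mult norm_inverse)
    \<comment> \<open>The datum divided by (z - x)^k; below it is read in the coordinate w through z
      = x - 1 / w.\<close>
    define g1 where "g1 z = exp (of_real (- k) * Ln (z - of_real x)) *s g z" for z
    have "vmoderate g1" unfolding g1_def by (intro vmoderate_smult moderate_on_Ln_power vg)
    then have "vmoderate (\<lambda>w. g1 ((of_real x * w + of_real (- 1)) / (of_real 1 * w + of_real 0)))"
      by (rule vmoderate_moebius) simp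
    then obtain q where q: "vmoderate q" "\<And>w. w \<in> \<H> \<Longrightarrow> (mat \<kappa> ** ctrans (\<rho> B)) *v q (w + of_real h) - q w =
        g1 ((of_real x * w + of_real (- 1)) / (of_real 1 * w + of_real 0))"
      using difference_equation_unitary[OF unitary_scaled[OF \<kappa> R(2)] _ h] by blast
    \<comment> \<open>The solution q is carried back by w = -1 / (z - x) and the factor (z - x)^k is
      restored.\<close>
    define f where "f z = exp (of_real k * Ln (z - of_real x)) *s q ((of_real 0 * z + of_real (- 1)) / (of_real 1 * z + of_real (- x)))" for z
    have "vmoderate f" unfolding f_def
      by (intro vmoderate_smult moderate_on_Ln_power vmoderate_moebius q) simp
    then show ?thesis
    proof (rule fin)
      fix z assume z: "z \<in> \<H>"
      define w where "w = - 1 / (z - of_real x)"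
      define E where "E = exp (of_real k * Ln (z - of_real x))"
      have w: "w \<in> \<H>" using z Im_moebius_real[of 0 z "- 1" 1 "- x"] zx[OF z] by (simp add: w_def)
      have "(of_real x * w + of_real (- 1)) / (of_real 1 * w + of_real 0) = z"
        using zx[OF z] by (simp add: w_def field_simps)
      then have qw: "(mat \<kappa> ** ctrans (\<rho> B)) *v q (w + of_real h) - q w = g1 z" using q(2)[OF w] by simp
      have fz: "f z = E *s q w" by (simp add: f_def E_def w_def)
      \<comment> \<open>Writing c z + d = c (z - x) + \<epsilon> splits the image of z into w and
        the constant -\<epsilon> c.\<close>
      have "- 1 / (act B z - of_real x) = w + of_real h"
      proof -
        have "- 1 / (act B z - of_real x) = - (of_real \<epsilon> * (of_real c * z + of_real d)) / (z - of_real x)"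
          unfolding actx[OF z] by simp
        also have "of_real c * z + of_real d = of_real c * (z - of_real x) + of_real (c * x + d)"
          by (simp add: algebra_simps)
        also have "- (of_real \<epsilon> * (of_real c * (z - of_real x) + of_real (c * x + d))) / (z - of_real x) =
            - of_real (\<epsilon> * \<epsilon>) / (z - of_real x) + of_real h"
          unfolding cx using zx[OF z] by (simp add: h_def field_simps)
        finally show ?thesis by (simp add: \<epsilon>2 w_def)
      qed
      then have fB: "f (act B z) = exp (of_real k * Ln (act B z - of_real x)) *s q (w + of_real h)"
        by (simp add: f_def)
      have jz: "rpow (of_real c * z + of_real d) k * exp (of_real k * Ln (act B z - of_real x)) = j * E"
        using j(2)[OF z] unfolding actx[OF z] E_def .
      have "(inverse (chi B) * rpow (of_real c * z + of_real d) k) *s (ctrans (\<rho> B) *v f (act B z)) =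
          (inverse (chi B) * (rpow (of_real c * z + of_real d) k * exp (of_real k * Ln (act B z - of_real x)))) *s
            (ctrans (\<rho> B) *v q (w + of_real h))"
        unfolding fB by (simp add: vector_scalar_commute vector_smult_assoc mult.assoc)
      also have "\<dots> = E *s ((mat \<kappa> ** ctrans (\<rho> B)) *v q (w + of_real h))"
        unfolding jz by (simp add: \<kappa>_def mat_mult_vector matrix_vector_mul_assoc[symmetric] vector_smult_assoc mult_ac)
      also have "\<dots> - f z = E *s g1 z"
        unfolding fz qw[symmetric] by (simp add: vector_ssub_ldistrib)
      also have "\<dots> = g z"
        by (simp add: g1_def E_def vector_smult_assoc flip: exp_add)
      finally show "(inverse (chi B) * rpow (of_real c * z + of_real d) k) *s (ctrans (\<rho> B) *v f (act B z)) - f z = g z" .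
    qed
  qed
qed

theorem theorem3p12:
  fixes \<Gamma> :: "(real^2^2) set"
    and k :: real
    and chi :: "real^2^2 \<Rightarrow> complex"
    and \<rho> :: "real^2^2 \<Rightarrow> complex^'p^'p"
  assumes "\<Gamma> \<subseteq> SL2Z"
    and "fuchsian_group \<Gamma>"
    and "finitely_generated \<Gamma>"
    and "first_kind \<Gamma>"
    and "\<exists>B\<in>\<Gamma>. parabolic B"
    and "multiplier_system (- k) \<Gamma> chi"
    and "unitary_representation \<Gamma> \<rho>"
  shows "H1 k chi \<rho> \<Gamma> = H1_par k chi \<rho> \<Gamma> \<and>
         cocycles k chi \<rho> \<Gamma> = parabolic_cocycles k chi \<rho> \<Gamma>"
proof -
  have "\<exists>Q\<in>PP. g B = slash k chi \<rho> Q B - Q"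
    if g: "g \<in> cocycles k chi \<rho> \<Gamma>" and B: "B \<in> \<Gamma>" "parabolic B" for g B
  proof (rule parabolic_coboundary[OF B(2)])
    show "norm (chi B) = 1" using assms(6) B by (simp add: multiplier_system_def)
    have "\<rho> B \<in> carrier unitary_group"
      using assms(7) B by (auto simp: unitary_representation_def hom_def)
    then show "ctrans (\<rho> B) ** \<rho> B = mat 1" "\<rho> B ** ctrans (\<rho> B) = mat 1"
      by (simp_all add: unitary_group_def ctrans_def)
    show "g B \<in> PP" using g B by (simp add: cocycles_def)
  qed
  then have "cocycles k chi \<rho> \<Gamma> = parabolic_cocycles k chi \<rho> \<Gamma>"
    by (auto simp: parabolic_cocycles_def)
  then show ?thesis by (simp add: H1_def H1_par_def)
qed

end
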